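(* Let $r\ge 1$ and $J\ge0$ be integers, $N=r2^J$, and let $\kappa$, $f_0$, $\tilde f_{m,J}$, $\overline\psi_1,\dots,\overline\psi_N$ be as defined in the context. Let $F_1=(a_{11},\dots,a_{1N})'\in\mathbb R^N$ and $K=(k_{ij})_{1\le i,j\le N}\in\mathbb R^{N\times N}$ be given by $$a_{1i}=\int_0^1\int_{\delta/\theta}^1\overline\psi_i(\eta)\,\kappa(\eta-\xi,\tau)\,f_0(\xi)\,d\xi\,d\eta,\qquad k_{ij}=\int_0^1\int_0^1\overline\psi_i(\eta)\,\overline\psi_j(\xi)\,\kappa(\eta-\xi,\tau)\,d\xi\,d\eta .$$ Then for every $1\le m\le M$, $$\tilde f_{m,J}=\Psi_J'\,K^{m-1}F_1,$$ that is, $\tilde f_{m,J}(z)=\sum_{i=1}^N (K^{m-1}F_1)_i\,\overline\psi_i(z)$ (as elements of $L^2([0,1])$).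
   Context: Parameters: $\hat r\in\mathbb R$, $\sigma>0$, $0<L<U$, $E>0$, $T>0$, an integer $M\ge1$, and $\tau=T/M$. Put $\mu=\hat r-\sigma^2/2$, $\alpha=-\mu/\sigma^2$, $c^2=\sigma^2/2$, $\theta=\ln(U/L)$, $E^*=\ln(E/L)$, $\delta=\max\{E^*,0\}$. $L^2([0,1])$ is the real Hilbert space with inner product $\langle f,g\rangle=\int_0^1 f(x)g(x)\,dx$. Kernel: $\kappa(z,\tau)=\dfrac{\theta}{\sqrt{4\pi c^2\tau}}\,e^{-(\theta z)^2/(4c^2\tau)}$. Integral operator on $L^2([0,1])$: $\mathcal K(f)(z)=\int_0^1\kappa(z-\xi,\tau)f(\xi)\,d\xi$. Initial function: $f_0(z)=L e^{-\alpha\theta z}(e^{\theta z}-e^{E^*})\mathbf 1_{\{\delta/\theta\le z\le1\}}$ on $[0,1]$. For $j\ge0$, $V_j\subset L^2([0,1])$ is the $r2^j$-dimensional space of functions whose restriction to each interval $[2^{-j}(i-1),2^{-j}i)$, $1\le i\le2^j$, is a polynomial of degree less than $r$. $P_J$ is the orthogonal projection of $L^2([0,1])$ onto $V_J$. Legendre multiwavelet basis: $\phi^l(x)=\sqrt{2l+1}\,p_l(2x-1)$ on $[0,1)$ and $0$ elsewhere, $0\le l\le r-1$, with $p_l$ the Legendre polynomial of degree $l$; $\psi^0,\dots,\psi^{r-1}$ is an orthonormal basis of $W_0$, the orthogonal complement of $V_0$ in $V_1$ (extended by $0$ outside $[0,1)$); $\psi^l_{j,k}(x)=2^{j/2}\psi^l(2^jx-k)$.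 The vector $\Psi_J=[\overline\psi_1,\dots,\overline\psi_N]'$, $N=r2^J$, lists the orthonormal basis of $V_J$ consisting of $\phi^0,\dots,\phi^{r-1}$ followed by the $\psi^l_{j,k}$ with $0\le j\le J-1$, $0\le k\le 2^j-1$, $0\le l\le r-1$. A prime denotes transpose. Approximations: $\tilde f_{1,J}=P_J\mathcal K(f_0)$ and $\tilde f_{m,J}=P_J\mathcal K(\tilde f_{m-1,J})$ for $m\ge2$. *)

theory Defs
  imports
    "HOL-Analysis.Analysis"
    "HOL-Computational_Algebra.Polynomial"
    "Jordan_Normal_Form.Matrix"
begin

section \<open>The space of square-integrable functions on the unit interval\<close>

text \<open>
  Elements of the Hilbert space are represented by functions on the reals of which only the
  values on \<open>{0..1}\<close> matter; equality in the Hilbert space is equality almost everywhere on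
  \<open>{0..1}\<close>. Every class has a Borel representative, so nothing is lost by using Borel
  measurability and Lebesgue-Borel measure.
\<close>

definition L2_unit :: "(real \<Rightarrow> real) set" where
  "L2_unit = {f. set_borel_measurable lborel {0..1} f \<and>
                 set_integrable lborel {0..1} (\<lambda>x. (f x)\<^sup>2)}"

definition L2_inner :: "(real \<Rightarrow> real) \<Rightarrow> (real \<Rightarrow> real) \<Rightarrow> real" where
  "L2_inner f g = (LBINT x:{0..1}. f x * g x)"

definition L2_eq :: "(real \<Rightarrow> real) \<Rightarrow> (real \<Rightarrow> real) \<Rightarrow> bool" where
  "L2_eq f g \<longleftrightarrow> (AE x in lborel. x \<in> {0..1} \<longrightarrow> f x = g x)"

text \<open>
  For \<open>f\<close> square-integrable and \<open>V\<close> a finite-dimensional subspace, the function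
  chosen here is unique up to equality almost everywhere on \<open>{0..1}\<close>.
\<close>

definition orth_proj :: "(real \<Rightarrow> real) set \<Rightarrow> (real \<Rightarrow> real) \<Rightarrow> (real \<Rightarrow> real)" where
  "orth_proj V f = (SOME g. g \<in> V \<and> (\<forall>h\<in>V. L2_inner (\<lambda>x. f x - g x) h = 0))"

definition orth_complement_in ::
  "(real \<Rightarrow> real) set \<Rightarrow> (real \<Rightarrow> real) set \<Rightarrow> (real \<Rightarrow> real) set" where
  "orth_complement_in V' V = {f \<in> V'. \<forall>g\<in>V. L2_inner f g = 0}"

definition orthonormal_basis_of ::
  "(real \<Rightarrow> real) set \<Rightarrow> nat \<Rightarrow> (nat \<Rightarrow> real \<Rightarrow> real) \<Rightarrow> bool" where
  "orthonormal_basis_of W n b \<longleftrightarrow>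
     (\<forall>i<n. b i \<in> W) \<and>
     (\<forall>i<n. \<forall>j<n. L2_inner (b i) (b j) = (if i = j then 1 else 0)) \<and>
     (\<forall>f\<in>W. \<exists>c :: nat \<Rightarrow> real. L2_eq f (\<lambda>x. \<Sum>i<n. c i * b i x))"


section \<open>Kernel, integral operator, initial function\<close>

definition theta :: "real \<Rightarrow> real \<Rightarrow> real" where
  "theta L U = ln (U / L)"

definition Estar :: "real \<Rightarrow> real \<Rightarrow> real" where
  "Estar L E = ln (E / L)"

definition delta :: "real \<Rightarrow> real \<Rightarrow> real" where
  "delta L E = max (Estar L E) 0"

definition mu :: "real \<Rightarrow> real \<Rightarrow> real" where
  "mu rhat \<sigma> = rhat - \<sigma>\<^sup>2 / 2"

definition alpha :: "real \<Rightarrow> real \<Rightarrow> real" where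
  "alpha rhat \<sigma> = - mu rhat \<sigma> / \<sigma>\<^sup>2"

definition c_sq :: "real \<Rightarrow> real" where
  "c_sq \<sigma> = \<sigma>\<^sup>2 / 2"

definition kappa :: "real \<Rightarrow> real \<Rightarrow> real \<Rightarrow> real \<Rightarrow> real \<Rightarrow> real" where
  "kappa \<sigma> L U z \<tau> =
     theta L U / sqrt (4 * pi * c_sq \<sigma> * \<tau>) *
     exp (- ((theta L U * z)\<^sup>2 / (4 * c_sq \<sigma> * \<tau>)))"

definition K_op :: "real \<Rightarrow> real \<Rightarrow> real \<Rightarrow> real \<Rightarrow> (real \<Rightarrow> real) \<Rightarrow> (real \<Rightarrow> real)" where
  "K_op \<sigma> L U \<tau> f = (\<lambda>z. LBINT \<xi>:{0..1}. kappa \<sigma> L U (z - \<xi>) \<tau> * f \<xi>)"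

definition f0 :: "real \<Rightarrow> real \<Rightarrow> real \<Rightarrow> real \<Rightarrow> real \<Rightarrow> (real \<Rightarrow> real)" where
  "f0 rhat \<sigma> L U E = (\<lambda>z.
     L * exp (- alpha rhat \<sigma> * theta L U * z) *
     (exp (theta L U * z) - exp (Estar L E)) *
     indicat_real {delta L E / theta L U .. 1} z)"


section \<open>Piecewise polynomials and Legendre multiwavelets\<close>

definition V_space :: "nat \<Rightarrow> nat \<Rightarrow> (real \<Rightarrow> real) set" where
  "V_space r j = {f \<in> L2_unit. \<forall>i\<in>{1..2^j}. \<exists>p :: real poly. degree p < r \<and>
     (\<forall>x\<in>{(real i - 1) / 2^j ..< real i / 2^j}. f x = poly p x)}"

definition W0_space :: "nat \<Rightarrow> (real \<Rightarrow> real) set" where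
  "W0_space r = orth_complement_in (V_space r 1) (V_space r 0)"

text \<open>Legendre polynomials, by Rodrigues' formula.\<close>

definition legendre :: "nat \<Rightarrow> real poly" where
  "legendre l = Polynomial.smult (1 / (2 ^ l * fact l)) ((pderiv ^^ l) ([:-1, 0, 1:] ^ l))"

definition phi :: "nat \<Rightarrow> real \<Rightarrow> real" where
  "phi l x = (if x \<in> {0..<1} then sqrt (2 * real l + 1) * poly (legendre l) (2 * x - 1) else 0)"

definition psi_scaled :: "(nat \<Rightarrow> real \<Rightarrow> real) \<Rightarrow> nat \<Rightarrow> nat \<Rightarrow> nat \<Rightarrow> real \<Rightarrow> real" where
  "psi_scaled \<psi> j k l x = 2 powr (real j / 2) * \<psi> l (2 ^ j * x - real k)"

definition wavelet_index :: "nat \<Rightarrow> nat \<Rightarrow> (nat \<times> nat \<times> nat) set" where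
  "wavelet_index r J = {(j, k, l). j < J \<and> k < 2 ^ j \<and> l < r}"

text \<open>
  Basis functions are numbered from \<open>0\<close>, matching vectors and matrices.
  The enumeration \<open>e\<close> of the triples \<open>(j, k, l)\<close> fixes the order of the
  wavelets that follow the scaling functions.
\<close>

definition psi_bar ::
  "nat \<Rightarrow> (nat \<Rightarrow> real \<Rightarrow> real) \<Rightarrow> (nat \<Rightarrow> nat \<times> nat \<times> nat) \<Rightarrow> nat \<Rightarrow> real \<Rightarrow> real" where
  "psi_bar r \<psi> e i = (if i < r then phi i else (case e i of (j, k, l) \<Rightarrow> psi_scaled \<psi> j k l))"


section \<open>The approximations\<close>

text \<open>Step \<open>0\<close> is the (unprojected) initial function, so that step \<open>1\<close> is \<open>P\<^sub>J (K f\<^sub>0)\<close>.\<close>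

primrec f_approx ::
  "real \<Rightarrow> real \<Rightarrow> real \<Rightarrow> real \<Rightarrow> real \<Rightarrow> real \<Rightarrow> nat \<Rightarrow> nat \<Rightarrow> nat \<Rightarrow> (real \<Rightarrow> real)" where
  "f_approx rhat \<sigma> L U E \<tau> r J 0 = f0 rhat \<sigma> L U E"
| "f_approx rhat \<sigma> L U E \<tau> r J (Suc m) =
     orth_proj (V_space r J) (K_op \<sigma> L U \<tau> (f_approx rhat \<sigma> L U E \<tau> r J m))"

end

(* The functions psi_bar form an orthonormal basis of V_J, so the projection P_J g is
   the sum of the <g, psi_bar_i> psi_bar_i; in these coordinates P_J K restricted to V_J is the
   matrix K, and P_J K f_0 has the coordinate vector F1.
   Orthonormality rests on Rodrigues' formula (phi) and on psi_{j,k} being a dilate of an element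
   of W_0, whose pullback of V_j lies in V_0. Completeness is an induction on J: on each dyadic
   interval of level J an element of V_{J+1} pulls back to V_1 = V_0 + W_0; the V_0-parts glue to an
   element of V_J and the W_0-parts are combinations of the psi_{J,k}. *)
theory Submission
  imports Defs
begin

section \<open>Linear algebra and orthogonal projections in L2\<close>

text \<open>Elements of the Hilbert space are functions here, not classes: \<open>V_space\<close>
  fixes no value at 1 or outside the unit interval, and \<open>orth_proj\<close> returns an
  arbitrary representative. Expansions in the basis therefore hold only almost everywhere, and the
  iteration survives this because the integral operator sends equivalent functions to the very same
  function. What makes the wavelets tractable is that each \<open>\<psi> l\<close> vanishes off
  \<open>{0..<1}\<close>. Dilates of one level then have disjoint supports and are piecewise
  polynomial, and their inner products can be taken over the whole line, where an affine
  substitution brings them back to level 0. The factor sqrt(2l+1) in \<open>phi\<close> requires the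
  exact integral of (x^2-1)^l, a Beta integral that is obtained from a two-term recursion.\<close>

lemma L2_unit_measurable:
  "f \<in> L2_unit \<Longrightarrow> (\<lambda>x. indicat_real {0..1} x * f x) \<in> borel_measurable borel"
  by (simp add: L2_unit_def set_borel_measurable_def)

lemma L2_unit_mult_integrable:
  assumes "f \<in> L2_unit" "g \<in> L2_unit"
  shows "set_integrable lborel {0..1} (\<lambda>x. f x * g x)"
proof (rule set_integrable_bound)
  show "set_integrable lborel {0..1} (\<lambda>x. (f x)\<^sup>2 + (g x)\<^sup>2)"
    using assms by (intro set_integral_add) (auto simp: L2_unit_def)
  \<comment> \<open>Only the cut-off functions are known to be Borel. Since the indicator is
    idempotent, the product of the cut-offs is the cut-off of the product.\<close>
  have "(\<lambda>x. (indicat_real {0..1} x * f x) * (indicat_real {0..1} x * g x)) \<in> borel_measurable borel"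
    using assms by (intro borel_measurable_times L2_unit_measurable)
  moreover have "(indicat_real {0..1} x * f x) * (indicat_real {0..1} x * g x)
      = indicat_real {0..1} x * (f x * g x)" for x
    by (simp add: indicator_def)
  ultimately show "set_borel_measurable lborel {0..1} (\<lambda>x. f x * g x)"
    by (simp add: set_borel_measurable_def)
  have "\<bar>f x * g x\<bar> \<le> (f x)\<^sup>2 + (g x)\<^sup>2" for x
  proof -
    have "2 * \<bar>f x\<bar> * \<bar>g x\<bar> \<le> \<bar>f x\<bar>\<^sup>2 + \<bar>g x\<bar>\<^sup>2"
      by (rule sum_squares_bound)
    moreover have "0 \<le> \<bar>f x\<bar> * \<bar>g x\<bar>"
      by simp
    ultimately show ?thesis
      unfolding abs_mult power2_abs by linarith
  qed
  then show "AE x in lborel. x \<in> {0..1} \<longrightarrow> norm (f x * g x) \<le> norm ((f x)\<^sup>2 + (g x)\<^sup>2)"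
    by (auto intro!: always_eventually)
qed

lemma L2_unit_bounded:
  assumes "set_borel_measurable lborel {0..1} f" and "\<And>x. x \<in> {0..1} \<Longrightarrow> \<bar>f x\<bar> \<le> C"
  shows "f \<in> L2_unit"
proof -
  have "set_integrable lborel {0..1} (\<lambda>x. (f x)\<^sup>2)"
  proof (rule set_integrable_bound)
    show "set_integrable lborel {0..1} (\<lambda>x::real. C\<^sup>2)"
      by (simp add: set_integrable_def)
    have "(\<lambda>x. (indicat_real {0..1} x * f x)\<^sup>2) \<in> borel_measurable borel"
      using assms(1) by (simp add: set_borel_measurable_def)
    moreover have "(indicat_real {0..1} x * f x)\<^sup>2 = indicat_real {0..1} x * (f x)\<^sup>2" for x
      by (simp add: indicator_def)
    ultimately show "set_borel_measurable lborel {0..1} (\<lambda>x. (f x)\<^sup>2)"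
      by (simp add: set_borel_measurable_def)
    show "AE x in lborel. x \<in> {0..1} \<longrightarrow> norm ((f x)\<^sup>2) \<le> norm (C\<^sup>2)"
      using assms(2) by (auto intro!: always_eventually abs_le_square_iff[THEN iffD1] order_trans[OF _ abs_ge_self])
  qed
  with assms(1) show ?thesis
    by (simp add: L2_unit_def)
qed

lemma L2_unit_const: "(\<lambda>x. c) \<in> L2_unit"
  by (rule L2_unit_bounded[where C = "\<bar>c\<bar>"]) (auto simp: set_borel_measurable_def)

lemma L2_unit_integrable: "f \<in> L2_unit \<Longrightarrow> set_integrable lborel {0..1} f"
  using L2_unit_mult_integrable[OF _ L2_unit_const[of 1]] by simp

lemma L2_unit_cmult:
  assumes "f \<in> L2_unit"
  shows "(\<lambda>x. c * f x) \<in> L2_unit"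
proof -
  have "(\<lambda>x. c * (indicat_real {0..1} x * f x)) \<in> borel_measurable borel"
    using assms by (intro borel_measurable_times L2_unit_measurable) auto
  then have "set_borel_measurable lborel {0..1} (\<lambda>x. c * f x)"
    by (simp add: set_borel_measurable_def mult.left_commute)
  then show ?thesis
    using assms by (auto simp: L2_unit_def power_mult_distrib)
qed

lemma L2_unit_add:
  assumes "f \<in> L2_unit" "g \<in> L2_unit"
  shows "(\<lambda>x. f x + g x) \<in> L2_unit"
proof -
  have "(\<lambda>x. indicat_real {0..1} x * f x + indicat_real {0..1} x * g x) \<in> borel_measurable borel"
    using assms by (intro borel_measurable_add L2_unit_measurable)
  then have "set_borel_measurable lborel {0..1} (\<lambda>x. f x + g x)"
    by (simp add: set_borel_measurable_def algebra_simps)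
  moreover have "set_integrable lborel {0..1} (\<lambda>x. (f x)\<^sup>2 + (g x)\<^sup>2 + 2 * (f x * g x))"
    using assms L2_unit_mult_integrable[OF assms]
    by (intro set_integral_add set_integrable_mult_right) (auto simp: L2_unit_def)
  then have "set_integrable lborel {0..1} (\<lambda>x. (f x + g x)\<^sup>2)"
    by (simp add: power2_sum mult.assoc)
  ultimately show ?thesis
    by (simp add: L2_unit_def)
qed

lemma L2_unit_sum:
  "(\<And>i. i \<in> I \<Longrightarrow> f i \<in> L2_unit) \<Longrightarrow> (\<lambda>x. \<Sum>i\<in>I. f i x) \<in> L2_unit"
  by (induction I rule: infinite_finite_induct) (auto intro: L2_unit_add L2_unit_const)

lemma L2_unit_lincomb:
  "(\<And>i. i \<in> I \<Longrightarrow> f i \<in> L2_unit) \<Longrightarrow> (\<lambda>x. \<Sum>i\<in>I. c i * f i x) \<in> L2_unit"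
  by (intro L2_unit_sum L2_unit_cmult)

lemma L2_unit_diff:
  assumes "f \<in> L2_unit" "g \<in> L2_unit"
  shows "(\<lambda>x. f x - g x) \<in> L2_unit"
  using L2_unit_add[OF assms(1) L2_unit_cmult[OF assms(2), of "-1"]] by simp

section \<open>Linearity of the inner product and its independence of representatives\<close>

lemma L2_inner_commute: "L2_inner f g = L2_inner g f"
  by (simp add: L2_inner_def mult.commute)

lemma L2_inner_cmult_left: "L2_inner (\<lambda>x. c * f x) g = c * L2_inner f g"
  by (simp add: L2_inner_def mult.assoc)

lemma L2_inner_add_left:
  "f \<in> L2_unit \<Longrightarrow> g \<in> L2_unit \<Longrightarrow> h \<in> L2_unit \<Longrightarrow>
    L2_inner (\<lambda>x. f x + g x) h = L2_inner f h + L2_inner g h"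
  by (simp add: L2_inner_def distrib_right set_integral_add L2_unit_mult_integrable)

lemma L2_inner_diff_left:
  "f \<in> L2_unit \<Longrightarrow> g \<in> L2_unit \<Longrightarrow> h \<in> L2_unit \<Longrightarrow>
    L2_inner (\<lambda>x. f x - g x) h = L2_inner f h - L2_inner g h"
  by (simp add: L2_inner_def left_diff_distrib set_integral_diff L2_unit_mult_integrable)

lemma L2_inner_lincomb_left:
  assumes "h \<in> L2_unit" "\<And>i. i \<in> I \<Longrightarrow> f i \<in> L2_unit"
  shows "L2_inner (\<lambda>x. \<Sum>i\<in>I. c i * f i x) h = (\<Sum>i\<in>I. c i * L2_inner (f i) h)"
  using assms(2)
proof (induction I rule: infinite_finite_induct)
  case (insert i I)
  then have "L2_inner (\<lambda>x. c i * f i x + (\<Sum>i\<in>I. c i * f i x)) h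
      = L2_inner (\<lambda>x. c i * f i x) h + L2_inner (\<lambda>x. \<Sum>i\<in>I. c i * f i x) h"
    by (intro L2_inner_add_left L2_unit_lincomb assms(1)) (auto intro: L2_unit_cmult)
  then show ?case
    using insert by (simp add: L2_inner_cmult_left)
qed (auto simp: L2_inner_def)

lemma set_integral_cong_L2_eq:
  assumes f: "f \<in> L2_unit" and g: "g \<in> L2_unit" and eq: "L2_eq f g"
    and h: "h \<in> borel_measurable borel"
  shows "(LBINT x:{0..1}. h x * f x) = (LBINT x:{0..1}. h x * g x)"
proof -
  have "(LBINT x. h x * (indicat_real {0..1} x * f x)) = (LBINT x. h x * (indicat_real {0..1} x * g x))"
  proof (rule integral_cong_AE)
    show "AE x in lborel. h x * (indicat_real {0..1} x * f x) = h x * (indicat_real {0..1} x * g x)"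
      using eq unfolding L2_eq_def by eventually_elim (auto simp: indicator_def)
  qed (use L2_unit_measurable[OF f] L2_unit_measurable[OF g] h in auto)
  then show ?thesis
    by (simp add: set_lebesgue_integral_def mult.left_commute)
qed

lemma L2_inner_cong_left:
  assumes "f \<in> L2_unit" "g \<in> L2_unit" "h \<in> L2_unit" "L2_eq f g"
  shows "L2_inner f h = L2_inner g h"
proof -
  \<comment> \<open>The weight in \<open>set_integral_cong_L2_eq\<close> must be Borel on the whole
    line, which holds for the cut-off of \<open>h\<close> but perhaps not for
    \<open>h\<close>.\<close>
  let ?h = "\<lambda>x. indicat_real {0..1} x * h x"
  have "(LBINT x:{0..1}. ?h x * f x) = (LBINT x:{0..1}. ?h x * g x)"
    using assms by (intro set_integral_cong_L2_eq L2_unit_measurable)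
  moreover have "(LBINT x:{0..1}. ?h x * f x) = L2_inner f h" for f
    unfolding L2_inner_def by (rule set_lebesgue_integral_cong) auto
  ultimately show ?thesis
    by simp
qed

lemma L2_inner_orthonormal_lincomb:
  fixes n :: nat
  assumes "\<And>i. i < n \<Longrightarrow> b i \<in> L2_unit" "\<And>i j. i < n \<Longrightarrow> j < n \<Longrightarrow> L2_inner (b i) (b j) = (if i = j then 1 else 0)"
    and "j < n"
  shows "L2_inner (\<lambda>x. \<Sum>i<n. c i * b i x) (b j) = c j"
proof -
  have "L2_inner (\<lambda>x. \<Sum>i<n. c i * b i x) (b j) = (\<Sum>i<n. c i * L2_inner (b i) (b j))"
    using assms by (intro L2_inner_lincomb_left) auto
  also have "\<dots> = (\<Sum>i<n. if i = j then c j else 0)"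
    using assms by (intro sum.cong) auto
  also have "\<dots> = c j"
    using assms by simp
  finally show ?thesis .
qed

text \<open>\<open>lin\<close> is a separate assumption because \<open>orthonormal_basis_of\<close>
  places the basis inside \<open>W\<close> without making \<open>W\<close> a subspace. The function
  that \<open>SOME\<close> picks is determined only up to a null set, hence \<open>L2_eq\<close> in
  the conclusion.\<close>

lemma orth_proj_orthonormal_basis:
  fixes n :: nat
  assumes basis: "orthonormal_basis_of W n b" and W: "W \<subseteq> L2_unit"
    and lin: "\<And>c :: nat \<Rightarrow> real. (\<lambda>x. \<Sum>i<n. c i * b i x) \<in> W"
    and f: "f \<in> L2_unit"
  shows "orth_proj W f \<in> W"
    and "L2_eq (orth_proj W f) (\<lambda>x. \<Sum>i<n. L2_inner f (b i) * b i x)"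
proof -
  have bW: "b i \<in> W" and b: "b i \<in> L2_unit" if "i < n" for i
    using basis W that by (auto simp: orthonormal_basis_of_def)
  have on: "L2_inner (b i) (b j) = (if i = j then 1 else 0)" if "i < n" "j < n" for i j
    using basis that by (simp add: orthonormal_basis_of_def)
  have span: "\<exists>c :: nat \<Rightarrow> real. L2_eq g (\<lambda>x. \<Sum>i<n. c i * b i x)" if "g \<in> W" for g
    using basis that by (simp add: orthonormal_basis_of_def)
  have lin2: "(\<lambda>x. \<Sum>i<n. c i * b i x) \<in> L2_unit" for c
    using lin W by blast
  let ?p = "\<lambda>x. \<Sum>i<n. L2_inner f (b i) * b i x"
  \<comment> \<open>\<open>SOME\<close> says something only if a witness exists; the Fourier sum
    \<open>?p\<close> is one.\<close>
  have "L2_inner (\<lambda>x. f x - ?p x) h = 0" if h: "h \<in> W" for h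
  proof -
    let ?d = "\<lambda>x. f x - ?p x"
    have d: "?d \<in> L2_unit"
      by (intro L2_unit_diff f lin2)
    have zero: "L2_inner (b i) ?d = 0" if "i < n" for i
      using L2_inner_diff_left[OF f lin2 b[OF that]] L2_inner_orthonormal_lincomb[OF b on that]
      by (simp add: L2_inner_commute[of "b i"])
    obtain c :: "nat \<Rightarrow> real" where c: "L2_eq h (\<lambda>x. \<Sum>i<n. c i * b i x)"
      using span h by blast
    have "L2_inner h ?d = L2_inner (\<lambda>x. \<Sum>i<n. c i * b i x) ?d"
      using h W by (intro L2_inner_cong_left lin2 d c) auto
    also have "\<dots> = (\<Sum>i<n. c i * L2_inner (b i) ?d)"
      using b by (intro L2_inner_lincomb_left d) auto
    also have "\<dots> = 0"
      using zero by simp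
    finally show ?thesis
      by (simp add: L2_inner_commute)
  qed
  then have "\<exists>g. g \<in> W \<and> (\<forall>h\<in>W. L2_inner (\<lambda>x. f x - g x) h = 0)"
    using lin by (intro exI[of _ ?p]) simp
  then have P: "orth_proj W f \<in> W \<and> (\<forall>h\<in>W. L2_inner (\<lambda>x. f x - orth_proj W f x) h = 0)"
    unfolding orth_proj_def by (rule someI_ex)
  then show W': "orth_proj W f \<in> W" ..
  then have W2: "orth_proj W f \<in> L2_unit"
    using W by blast
  obtain c :: "nat \<Rightarrow> real" where c: "L2_eq (orth_proj W f) (\<lambda>x. \<Sum>i<n. c i * b i x)"
    using span W' by blast
  \<comment> \<open>Whatever element was chosen, the orthogonality of its residual forces its
    coordinates to be the Fourier coefficients.\<close>
  have "c i = L2_inner f (b i)" if i: "i < n" for i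
  proof -
    have "c i = L2_inner (orth_proj W f) (b i)"
      using L2_inner_orthonormal_lincomb[OF b on i] L2_inner_cong_left[OF W2 lin2 b[OF i] c] by simp
    also have "\<dots> = L2_inner f (b i)"
      using P bW[OF i] L2_inner_diff_left[OF f W2 b[OF i]] by simp
    finally show ?thesis .
  qed
  then have "(\<lambda>x. \<Sum>i<n. c i * b i x) = ?p"
    by simp
  with c show "L2_eq (orth_proj W f) ?p"
    by simp
qed

section \<open>Legendre polynomials\<close>

text \<open>Half the integral of \<open>p\<close> over [-1, 1], written with the shifted argument
  that occurs in \<open>phi\<close>.\<close>

definition poly_integral :: "real poly \<Rightarrow> real" where
  "poly_integral p = (LBINT x:{0..1}. poly p (2 * x - 1))"

lemma poly_L2_unit: "(\<lambda>x. poly p (a * x + b)) \<in> L2_unit"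
proof -
  have "compact ((\<lambda>x. poly p (a * x + b)) ` {0..1::real})"
    by (intro compact_continuous_image) (auto intro!: continuous_intros)
  then obtain C where "\<forall>y\<in>(\<lambda>x. poly p (a * x + b)) ` {0..1::real}. norm y \<le> C"
    using compact_imp_bounded bounded_iff by blast
  moreover have "(\<lambda>x. poly p (a * x + b)) \<in> borel_measurable borel"
    by (intro borel_measurable_continuous_onI continuous_intros)
  then have "set_borel_measurable lborel {0..1} (\<lambda>x. poly p (a * x + b))"
    by (simp add: set_borel_measurable_def)
  ultimately show ?thesis
    by (intro L2_unit_bounded[where C = C]) auto
qed

lemma poly_integral_integrable:
  "set_integrable lborel {0..1} (\<lambda>x. poly (p :: real poly) (2 * x - 1))"
  using L2_unit_integrable[OF poly_L2_unit[of p 2 "-1"]] by simp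

lemma poly_integral_add: "poly_integral (p + q) = poly_integral p + poly_integral q"
  by (simp add: poly_integral_def poly_integral_integrable set_integral_add)

lemma poly_integral_smult: "poly_integral (Polynomial.smult c p) = c * poly_integral p"
  by (simp add: poly_integral_def)

lemma poly_integral_pderiv: "poly_integral (pderiv p) = (poly p 1 - poly p (-1)) / 2"
proof -
  have "poly_integral (pderiv p) = poly p (2 * 1 - 1) / 2 - poly p (2 * 0 - 1) / 2"
    unfolding poly_integral_def set_lebesgue_integral_def
  proof (rule integral_FTC_atLeastAtMost)
    fix x :: real
    have "((\<lambda>x. poly p (2 * x - 1) / 2) has_real_derivative poly (pderiv p) (2 * x - 1)) (at x within {0..1})"
      by (auto intro!: derivative_eq_intros)
    then show "((\<lambda>x. poly p (2 * x - 1) / 2) has_vector_derivative poly (pderiv p) (2 * x - 1)) (at x within {0..1})"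
      by (simp add: has_real_derivative_iff_has_vector_derivative)
  qed (auto intro!: continuous_intros)
  then show ?thesis
    by (simp add: diff_divide_distrib)
qed

lemma poly_integral_by_parts:
  assumes "poly p 1 = 0" "poly p (-1) = 0"
  shows "poly_integral (pderiv p * q) = - poly_integral (p * pderiv q)"
  using poly_integral_pderiv[of "p * q"] assms
  by (simp add: pderiv_mult poly_integral_add mult.commute)

text \<open>The base of the power in Rodrigues' formula. Its roots 1 and -1 are the end points of
  integration, so boundary terms vanish.\<close>

abbreviation legendre_weight :: "real poly" where
  "legendre_weight \<equiv> [:-1, 0, 1:]"

lemma power_dvd_pderiv:
  fixes w p :: "'a::idom poly"
  assumes "w ^ Suc n dvd p"
  shows "w ^ n dvd pderiv p"
proof -
  obtain q where "p = w ^ Suc n * q"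
    using assms by (elim dvdE)
  then have "pderiv p = w ^ Suc n * pderiv q + q * (Polynomial.smult (of_nat (Suc n)) (w ^ n) * pderiv w)"
    by (simp only: pderiv_mult pderiv_power_Suc)
  then show ?thesis
    by (simp add: dvd_add dvd_smult)
qed

lemma power_dvd_higher_pderiv:
  fixes w p :: "'a::idom poly"
  assumes "w ^ (n + k) dvd p"
  shows "w ^ n dvd (pderiv ^^ k) p"
  using assms
proof (induction k arbitrary: n)
  case (Suc k)
  have "w ^ Suc n dvd (pderiv ^^ k) p"
    using Suc.prems by (intro Suc.IH) simp
  then show ?case
    by (simp add: power_dvd_pderiv del: power_Suc)
qed simp

text \<open>By the product rule each derivative uses up at most one factor of the weight, so for
  \<open>k < l\<close> at least one factor is left.\<close>

lemma higher_pderiv_legendre_weight_roots: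
  assumes "k < l"
  shows "poly ((pderiv ^^ k) (legendre_weight ^ l)) 1 = 0"
    and "poly ((pderiv ^^ k) (legendre_weight ^ l)) (-1) = 0"
proof -
  have "legendre_weight ^ 1 dvd (pderiv ^^ k) (legendre_weight ^ l)"
    using assms by (intro power_dvd_higher_pderiv le_imp_power_dvd) simp
  then obtain q where "(pderiv ^^ k) (legendre_weight ^ l) = legendre_weight * q"
    by (elim dvdE) simp
  then show "poly ((pderiv ^^ k) (legendre_weight ^ l)) 1 = 0"
    and "poly ((pderiv ^^ k) (legendre_weight ^ l)) (-1) = 0"
    by simp_all
qed

text \<open>Each integration by parts moves one derivative onto \<open>q\<close>. The boundary terms
  vanish because fewer than \<open>l\<close> derivatives remain on the power of the weight.\<close>

lemma poly_integral_higher_by_parts: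
  assumes "k \<le> l"
  shows "poly_integral ((pderiv ^^ l) (legendre_weight ^ l) * q)
    = (-1) ^ k * poly_integral ((pderiv ^^ (l - k)) (legendre_weight ^ l) * (pderiv ^^ k) q)"
  using assms
proof (induction k)
  case (Suc k)
  define m where "m = l - Suc k"
  have m: "l - k = Suc m" "m < l"
    using Suc.prems by (auto simp: m_def)
  have "poly_integral ((pderiv ^^ l) (legendre_weight ^ l) * q)
    = (-1) ^ k * poly_integral (pderiv ((pderiv ^^ m) (legendre_weight ^ l)) * (pderiv ^^ k) q)"
    using Suc m by simp
  also have "\<dots> = (-1) ^ Suc k * poly_integral ((pderiv ^^ m) (legendre_weight ^ l) * (pderiv ^^ Suc k) q)"
    by (simp add: poly_integral_by_parts higher_pderiv_legendre_weight_roots[OF m(2)])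
  finally show ?case
    by (simp add: m_def)
qed simp

text \<open>Only the monomial of degree \<open>n\<close> survives, as a constant. With an inequality
  in the hypothesis the lemma also covers polynomials of smaller degree, whose \<open>n\<close>-th
  derivative is 0.\<close>

lemma higher_pderiv_degree:
  fixes p :: "'a::{comm_semiring_1,semiring_no_zero_divisors,semiring_char_0} poly"
  assumes "degree p \<le> n"
  shows "(pderiv ^^ n) p = [:fact n * Polynomial.coeff p n:]"
proof (rule poly_eqI)
  fix i
  show "Polynomial.coeff ((pderiv ^^ n) p) i = Polynomial.coeff [:fact n * Polynomial.coeff p n:] i"
    using assms
    by (cases i) (auto simp: coeff_higher_pderiv pochhammer_fact coeff_eq_0 of_nat_fact)
qed

lemma degree_legendre_weight_power: "degree (legendre_weight ^ l) = 2 * l"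
  by (simp add: degree_power_eq)

lemma coeff_legendre_weight_power: "Polynomial.coeff (legendre_weight ^ l) (2 * l) = 1"
  using lead_coeff_power[of legendre_weight l] by (simp add: degree_legendre_weight_power)

text \<open>As (2x-1)^2 - 1 = -4x(1-x), this is (-4)^l times the Beta integral B(l+1, l+1).\<close>

lemma poly_integral_legendre_weight_power:
  "poly_integral (legendre_weight ^ l) = (-1) ^ l * (2 ^ l * fact l)\<^sup>2 / fact (2 * l + 1)"
proof (induction l)
  case 0
  show ?case
    by (simp add: poly_integral_def set_lebesgue_integral_def)
next
  case (Suc l)
  let ?w = legendre_weight
  \<comment> \<open>x w^(l+1) vanishes at both end points, so its derivative integrates to 0.
    Replacing x^2 by w + 1 in that derivative gives (2l+3) I(l+1) + 2(l+1) I(l) = 0 for the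
    integrals I(l) of w^l.\<close>
  have "pderiv ([:0, 1:] * ?w ^ Suc l) = ?w ^ Suc l + Polynomial.smult (2 * (real l + 1)) ([:0, 1:] * [:0, 1:] * ?w ^ l)"
    by (simp add: pderiv_mult pderiv_power_Suc pderiv_pCons add.commute del: power_Suc)
  also have "[:0, 1:] * [:0, 1:] = ?w + 1"
    by (simp add: one_pCons)
  also have "?w ^ Suc l + Polynomial.smult c ((?w + 1) * ?w ^ l)
    = Polynomial.smult (c + 1) (?w ^ Suc l) + Polynomial.smult c (?w ^ l)" for c
    by (simp only: power_Suc distrib_right smult_add_left smult_add_right mult_1_left smult_1_left ac_simps)
  finally have "poly_integral (pderiv ([:0, 1:] * ?w ^ Suc l))
    = (2 * (real l + 1) + 1) * poly_integral (?w ^ Suc l) + 2 * (real l + 1) * poly_integral (?w ^ l)"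
    by (simp only: poly_integral_add poly_integral_smult)
  moreover have "poly_integral (pderiv ([:0, 1:] * ?w ^ Suc l)) = 0"
    unfolding poly_integral_pderiv by simp
  ultimately have rec: "(2 * (real l + 1) + 1) * poly_integral (?w ^ Suc l)
    = - (2 * (real l + 1) * poly_integral (?w ^ l))"
    by linarith
  have "poly_integral (?w ^ Suc l) = - (2 * (real l + 1) * poly_integral (?w ^ l)) / (2 * (real l + 1) + 1)"
    unfolding rec[symmetric] by (rule nonzero_mult_div_cancel_left[symmetric]) simp
  also have "\<dots> = - (2 * (real l + 1) * ((-1) ^ l * (2 ^ l * fact l)\<^sup>2 / fact (2 * l + 1))) / (2 * real l + 3)"
    unfolding Suc.IH by simp
  also have "\<dots> = (-1) ^ Suc l * (2 ^ Suc l * fact (Suc l))\<^sup>2 / fact (2 * Suc l + 1)"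
  proof -
    have "fact (2 * Suc l + 1) = (2 * real l + 3) * (2 * (real l + 1)) * (fact (2 * l + 1) :: real)"
      by (simp add: algebra_simps)
    moreover have "fact (Suc l) = (real l + 1) * fact l"
      by simp
    ultimately show ?thesis
      by (simp add: divide_simps power2_eq_square del: fact_Suc) (simp add: algebra_simps)
  qed
  finally show ?case .
qed

lemma degree_legendre: "degree (legendre l) = l"
  by (simp add: legendre_def degree_higher_pderiv degree_legendre_weight_power)

text \<open>Differentiating x^(2l) \<open>l\<close> times produces the factor (l+1)(l+2)...(2l),
  which is \<open>pochhammer (Suc l) l\<close>.\<close>

lemma coeff_legendre_weight_deriv:
  "Polynomial.coeff ((pderiv ^^ l) (legendre_weight ^ l)) l = fact (2 * l) / fact l"
proof -
  have "pochhammer (Suc l) l * fact l = (fact (l + l) :: nat)"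
    by (metis pochhammer_fact pochhammer_product' of_nat_id plus_1_eq_Suc mult.commute)
  then have "real (pochhammer (Suc l) l) * fact l = fact (2 * l)"
    by (metis mult_2 of_nat_fact of_nat_mult)
  moreover have "Polynomial.coeff ((pderiv ^^ l) (legendre_weight ^ l)) l = real (pochhammer (Suc l) l)"
    using coeff_legendre_weight_power[of l]
    by (simp add: coeff_higher_pderiv mult_2 pochhammer_of_nat[symmetric] del: of_nat_Suc)
  ultimately show ?thesis
    by (simp add: field_simps)
qed

text \<open>All \<open>m\<close> derivatives of Rodrigues' formula are moved onto the factor of
  smaller degree, which they annihilate.\<close>

lemma legendre_orthogonal:
  assumes "l < m"
  shows "poly_integral (legendre m * legendre l) = 0"
proof -
  have "(pderiv ^^ m) (legendre l) = 0"
    using assms by (subst higher_pderiv_degree) (auto simp: degree_legendre coeff_eq_0)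
  then have "poly_integral ((pderiv ^^ m) (legendre_weight ^ m) * legendre l) = 0"
    by (subst poly_integral_higher_by_parts[of m m]) (auto simp: poly_integral_def)
  then show ?thesis
    by (simp add: legendre_def[of m] poly_integral_smult)
qed

text \<open>After \<open>l\<close> integrations by parts the second factor is the constant (2l)!,
  and the sign (-1)^l cancels that of the Beta integral. The factor 2l+1 is the quotient of (2l+1)!
  and (2l)!.\<close>

lemma legendre_norm: "(2 * real l + 1) * poly_integral (legendre l * legendre l) = 1"
proof -
  let ?d = "(pderiv ^^ l) (legendre_weight ^ l)"
  have "(pderiv ^^ l) ?d = [:fact (2 * l):]"
    by (subst higher_pderiv_degree)
      (auto simp: degree_higher_pderiv degree_legendre_weight_power coeff_legendre_weight_deriv)
  then have "poly_integral (?d * ?d) = (-1) ^ l * poly_integral (legendre_weight ^ l * [:fact (2 * l):])"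
    by (subst poly_integral_higher_by_parts[of l l]) auto
  also have "\<dots> = (-1) ^ l * (fact (2 * l) * poly_integral (legendre_weight ^ l))"
    by (simp add: poly_integral_smult)
  also have "\<dots> = ((-1) ^ l * (-1) ^ l) * (fact (2 * l) * (2 ^ l * fact l)\<^sup>2 / fact (2 * l + 1))"
    unfolding poly_integral_legendre_weight_power by simp
  also have "\<dots> = (2 ^ l * fact l)\<^sup>2 / (2 * real l + 1)"
    by (simp add: power_mult_distrib[symmetric] add.commute)
  finally have "poly_integral (?d * ?d) = (2 ^ l * fact l)\<^sup>2 / (2 * real l + 1)" .
  then show ?thesis
    by (simp add: legendre_def poly_integral_smult power2_eq_square)
qed

text \<open>Dyadic cells and scaling functions are described on \<open>{0..<1}\<close>, whereas
  \<open>L2_eq\<close> speaks of \<open>{0..1}\<close>; this bridges the two.\<close>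

lemma AE_unit_interval_half_open: "AE x in lborel. x \<in> {0..1} \<longrightarrow> (x::real) \<in> {0..<1}"
  using AE_lborel_singleton[of "1::real"] by eventually_elim auto

text \<open>The indicator confines the argument of \<open>p\<close> to a compact interval, so one
  bound serves for all \<open>a\<close> and \<open>b\<close>. Both \<open>phi\<close> and the pieces
  of a dyadic piecewise polynomial have this form.\<close>

lemma poly_piece_L2_unit: "(\<lambda>x. indicat_real {0..<1} (a * x + b) * poly p (a * x + b)) \<in> L2_unit"
proof -
  have "compact (poly p ` {0..1::real})"
    by (intro compact_continuous_image) (auto intro!: continuous_intros)
  then obtain C where "\<forall>y\<in>poly p ` {0..1::real}. norm y \<le> C"
    using compact_imp_bounded bounded_iff by blast
  then have C: "\<bar>poly p y\<bar> \<le> C" if "y \<in> {0..1}" for y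
    using that by auto
  then have "0 \<le> C"
    using order_trans[OF abs_ge_zero C[of 0]] by simp
  have [measurable]: "(\<lambda>x. poly p (a * x + b)) \<in> borel_measurable borel"
    by (intro borel_measurable_continuous_onI continuous_intros)
  have "set_borel_measurable lborel {0..1} (\<lambda>x. indicat_real {0..<1} (a * x + b) * poly p (a * x + b))"
    unfolding set_borel_measurable_def by measurable
  then show ?thesis
    by (rule L2_unit_bounded[where C = C]) (use C \<open>0 \<le> C\<close> in \<open>auto simp: indicator_def\<close>)
qed

lemma phi_L2_unit: "phi l \<in> L2_unit"
proof -
  have phi: "phi l = (\<lambda>x. sqrt (2 * real l + 1) *
      (indicat_real {0..<1} (1 * x + 0) * poly (legendre l \<circ>\<^sub>p [:-1, 2:]) (1 * x + 0)))"
    by (auto simp: phi_def poly_pcompose indicator_def fun_eq_iff mult.commute)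
  show ?thesis
    unfolding phi by (intro L2_unit_cmult poly_piece_L2_unit)
qed

lemma phi_orthonormal: "L2_inner (phi l) (phi m) = (if l = m then 1 else 0)"
proof -
  \<comment> \<open>Without the cut-off at 1 the product is a polynomial in 2x - 1, so the inner
    product becomes a \<open>poly_integral\<close>.\<close>
  define P where "P l = (\<lambda>x. sqrt (2 * real l + 1) * poly (legendre l) (2 * x - 1))" for l
  have P: "P l \<in> L2_unit" for l
    using L2_unit_cmult[OF poly_L2_unit[of "legendre l" 2 "-1"]] by (simp add: P_def)
  have eq: "L2_eq (phi l) (P l)" for l
    unfolding L2_eq_def using AE_unit_interval_half_open
    by eventually_elim (simp add: phi_def P_def)
  have "L2_inner (phi l) (phi m) = L2_inner (P l) (phi m)"
    by (rule L2_inner_cong_left[OF phi_L2_unit P phi_L2_unit eq])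
  also have "\<dots> = L2_inner (phi m) (P l)"
    by (rule L2_inner_commute)
  also have "\<dots> = L2_inner (P m) (P l)"
    by (rule L2_inner_cong_left[OF phi_L2_unit P P eq])
  also have "\<dots> = (LBINT x:{0..1}. (sqrt (2 * real l + 1) * sqrt (2 * real m + 1)) * poly (legendre m * legendre l) (2 * x - 1))"
    unfolding L2_inner_def P_def by (simp add: ac_simps)
  also have "\<dots> = sqrt (2 * real l + 1) * sqrt (2 * real m + 1) * poly_integral (legendre m * legendre l)"
    by (simp only: poly_integral_def set_integral_mult_right)
  also have "\<dots> = (if l = m then 1 else 0)"
  proof (cases l m rule: linorder_cases)
    case equal
    then show ?thesis
      using legendre_norm[of l] by simp
  qed (use legendre_orthogonal[of l m] legendre_orthogonal[of m l] in \<open>auto simp: mult.commute[of "legendre m"]\<close>)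
  finally show ?thesis .
qed

text \<open>Triangular elimination of the top coefficient. The bound on \<open>p\<close> is put on
  coefficients so that \<open>n = 0\<close> means \<open>p = 0\<close>, which no bound on
  \<open>degree\<close> can express.\<close>

lemma poly_span_degree_basis:
  fixes q :: "nat \<Rightarrow> 'a::field poly"
  assumes "\<And>l. degree (q l) = l" "\<And>l. q l \<noteq> 0" and "\<And>i. n \<le> i \<Longrightarrow> Polynomial.coeff p i = 0"
  shows "\<exists>a. p = (\<Sum>l<n. Polynomial.smult (a l) (q l))"
  using assms(3)
proof (induction n arbitrary: p)
  case 0
  then show ?case
    by (simp add: poly_eq_iff)
next
  case (Suc n)
  define c where "c = Polynomial.coeff p n / Polynomial.coeff (q n) n"
  have nz: "Polynomial.coeff (q n) n \<noteq> 0"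
    using assms(1)[of n] assms(2)[of n] by (metis leading_coeff_0_iff)
  have "Polynomial.coeff (p - Polynomial.smult c (q n)) i = 0" if "n \<le> i" for i
  proof (cases "i = n")
    case True
    then show ?thesis
      using nz by (simp add: c_def)
  next
    case False
    then show ?thesis
      using that Suc.prems[of i] assms(1)[of n] by (simp add: coeff_eq_0)
  qed
  then obtain a where a: "p - Polynomial.smult c (q n) = (\<Sum>l<n. Polynomial.smult (a l) (q l))"
    using Suc.IH by blast
  have "p = (p - Polynomial.smult c (q n)) + Polynomial.smult c (q n)"
    by simp
  also have "\<dots> = (\<Sum>l<Suc n. Polynomial.smult ((a(n := c)) l) (q l))"
    unfolding a by simp
  finally show ?case
    by blast
qed

lemma phi_span:
  assumes "degree (p :: real poly) < r"
  shows "\<exists>a. \<forall>x\<in>{0..<1}. poly p x = (\<Sum>l<r. a l * phi l x)"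
proof -
  \<comment> \<open>The polynomial that agrees with \<open>phi l\<close> on \<open>{0..<1}\<close>;
    composing with 2x - 1 preserves the degree.\<close>
  define q where "q l = Polynomial.smult (sqrt (2 * real l + 1)) (legendre l \<circ>\<^sub>p [:-1, 2:])" for l
  have s: "sqrt (2 * real l + 1) \<noteq> 0" for l
    by simp
  have deg: "degree (q l) = l" for l
    using s[of l] by (simp add: q_def degree_pcompose degree_legendre)
  have l0: "legendre l \<noteq> 0" for l
    using legendre_norm[of l] by (auto simp: poly_integral_def)
  have nz: "q l \<noteq> 0" for l
    using s[of l] l0[of l] pcompose_eq_0_iff[of "[:-1, 2:]" "legendre l"] by (simp add: q_def)
  obtain a where "p = (\<Sum>l<r. Polynomial.smult (a l) (q l))"
    using poly_span_degree_basis[of q r p, OF deg nz] assms by (metis coeff_eq_0 order_less_le_trans)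
  then have "poly p x = (\<Sum>l<r. a l * phi l x)" if "x \<in> {0..<1}" for x
    using that by (simp add: poly_sum q_def poly_pcompose phi_def algebra_simps)
  then show ?thesis
    by blast
qed

section \<open>Dyadic piecewise polynomials\<close>

lemma L2_unit_cong:
  assumes "f \<in> L2_unit" "\<And>x. x \<in> {0..1} \<Longrightarrow> f x = g x"
  shows "g \<in> L2_unit"
proof -
  have "set_borel_measurable lborel {0..1} g \<longleftrightarrow> set_borel_measurable lborel {0..1} f"
    unfolding set_borel_measurable_def using assms(2)
    by (intro arg_cong[of _ _ "\<lambda>h. h \<in> borel_measurable lborel"]) (auto simp: indicator_def)
  moreover have "set_integrable lborel {0..1} (\<lambda>x. (g x)\<^sup>2) \<longleftrightarrow> set_integrable lborel {0..1} (\<lambda>x. (f x)\<^sup>2)"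
    using assms(2) by (intro set_integrable_cong) auto
  ultimately show ?thesis
    using assms(1) by (simp add: L2_unit_def)
qed

text \<open>The index is the integer part of 2^j x. Its uniqueness is what collapses a sum over
  dilates to a single term.\<close>

lemma dyadic_index:
  fixes x :: real
  assumes "x \<in> {0..<1}"
  obtains k0 :: nat where "k0 < 2 ^ j" "\<And>k::nat. 2 ^ j * x - real k \<in> {0..<1} \<longleftrightarrow> k = k0"
proof
  have "0 \<le> 2 ^ j * x" "2 ^ j * x < 2 ^ j"
    using assms by auto
  then have "\<lfloor>2 ^ j * x\<rfloor> < 2 ^ j"
    by (simp add: floor_less_iff)
  then show "nat \<lfloor>2 ^ j * x\<rfloor> < 2 ^ j"
    by (simp add: nat_less_iff)
  show "2 ^ j * x - real k \<in> {0..<1} \<longleftrightarrow> k = nat \<lfloor>2 ^ j * x\<rfloor>" for k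
    using \<open>0 \<le> 2 ^ j * x\<close> by (auto simp: eq_nat_nat_iff) linarith+
qed

text \<open>The working form of \<open>V_space\<close>: cells are numbered from 0 and each piece is
  pulled back to \<open>{0..<1}\<close>. Square integrability drops out because on
  \<open>{0..1}\<close> such an \<open>f\<close> is a finite sum of polynomial pieces plus its value
  at the end point.\<close>

lemma V_space_iff:
  "f \<in> V_space r j \<longleftrightarrow>
    (\<forall>k<2 ^ j. \<exists>p. degree p < r \<and> (\<forall>y\<in>{0..<1}. f ((y + real k) / 2 ^ j) = poly p y))"
proof (intro iffI allI impI)
  fix k :: nat
  assume f: "f \<in> V_space r j" and k: "k < 2 ^ j"
  have "Suc k \<in> {1..2 ^ j}"
    using k by auto
  then obtain p where p: "degree p < r" "\<forall>x\<in>{(real (Suc k) - 1) / 2 ^ j..<real (Suc k) / 2 ^ j}. f x = poly p x"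
    using f unfolding V_space_def by blast
  have "f ((y + real k) / 2 ^ j) = poly (p \<circ>\<^sub>p [:real k / 2 ^ j, 1 / 2 ^ j:]) y" if "y \<in> {0..<1}" for y
    using p(2)[rule_format, of "(y + real k) / 2 ^ j"] that
    by (simp add: poly_pcompose divide_right_mono divide_strict_right_mono add_divide_distrib add.commute)
  then show "\<exists>p. degree p < r \<and> (\<forall>y\<in>{0..<1}. f ((y + real k) / 2 ^ j) = poly p y)"
    using p(1) by (intro exI[of _ "p \<circ>\<^sub>p [:real k / 2 ^ j, 1 / 2 ^ j:]"]) (simp add: degree_pcompose)
next
  assume "\<forall>k<2 ^ j. \<exists>p. degree p < r \<and> (\<forall>y\<in>{0..<1}. f ((y + real k) / 2 ^ j) = poly p y)"
  then obtain p where p: "\<And>k. k < 2 ^ j \<Longrightarrow> degree (p k) < r"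
    "\<And>k y. k < 2 ^ j \<Longrightarrow> y \<in> {0..<1} \<Longrightarrow> f ((y + real k) / 2 ^ j) = poly (p k) y"
    by metis
  have fp: "f x = poly (p k) (2 ^ j * x - real k)" if "k < 2 ^ j" "2 ^ j * x - real k \<in> {0..<1}" for k x
    using p(2)[OF that] by simp
  let ?g = "\<lambda>k x. indicat_real {0..<1} (2 ^ j * x + - real k) * poly (p k) (2 ^ j * x + - real k)"
  \<comment> \<open>The half-open cells miss the point 1, where \<open>f\<close> is arbitrary;
    \<open>?e\<close> carries that value.\<close>
  let ?e = "\<lambda>x. f 1 * indicat_real {1} x"
  have "?e \<in> L2_unit"
    by (rule L2_unit_bounded[where C = "\<bar>f 1\<bar>"]) (auto simp: set_borel_measurable_def indicator_def)
  then have "(\<lambda>x. (\<Sum>k<2 ^ j. ?g k x) + ?e x) \<in> L2_unit"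
    by (intro L2_unit_add L2_unit_sum poly_piece_L2_unit)
  moreover have "(\<Sum>k<2 ^ j. ?g k x) + ?e x = f x" if x: "x \<in> {0..1}" for x
  proof (cases "x = 1")
    case True
    have "2 ^ j + - real k \<notin> {0..<1}" if "k < 2 ^ j" for k
    proof -
      have "Suc k \<le> 2 ^ j"
        using that by simp
      then have "real (Suc k) \<le> 2 ^ j"
        by (metis of_nat_le_iff of_nat_numeral of_nat_power)
      then show ?thesis
        by auto
    qed
    then show ?thesis
      using True by (simp add: sum.neutral)
  next
    case False
    then have x': "x \<in> {0..<1}"
      using x by auto
    obtain k0 where k0: "k0 < 2 ^ j" "\<And>k::nat. 2 ^ j * x - real k \<in> {0..<1} \<longleftrightarrow> k = k0"
      using dyadic_index[OF x', of j] by blast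
    have "(\<Sum>k<2 ^ j. ?g k x) = (\<Sum>k<2 ^ j. if k = k0 then f x else 0)"
      using k0(2) fp by (intro sum.cong) (auto simp: indicator_def)
    then show ?thesis
      using False k0(1) by simp
  qed
  ultimately have "f \<in> L2_unit"
    by (rule L2_unit_cong)
  moreover have "\<exists>q. degree q < r \<and> (\<forall>x\<in>{(real i - 1) / 2 ^ j..<real i / 2 ^ j}. f x = poly q x)"
    if i: "i \<in> {1..2 ^ j}" for i
  proof -
    obtain k where k: "i = Suc k" "k < 2 ^ j"
      using i by (cases i) auto
    have "f x = poly (p k \<circ>\<^sub>p [:- real k, 2 ^ j:]) x" if "x \<in> {(real i - 1) / 2 ^ j..<real i / 2 ^ j}" for x
      using fp[OF k(2), of x] that k(1)
      by (simp add: poly_pcompose pos_divide_le_eq pos_less_divide_eq algebra_simps)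
    then show ?thesis
      using p(1)[OF k(2)] by (intro exI[of _ "p k \<circ>\<^sub>p [:- real k, 2 ^ j:]"]) (simp add: degree_pcompose)
  qed
  ultimately show "f \<in> V_space r j"
    by (simp add: V_space_def)
qed

section \<open>Vector space operations, rescaling and nesting of the dyadic spaces\<close>

lemma V_space_L2_unit: "V_space r j \<subseteq> L2_unit"
  by (auto simp: V_space_def)

lemma V_space_cmult:
  assumes "f \<in> V_space r j"
  shows "(\<lambda>x. c * f x) \<in> V_space r j"
  unfolding V_space_iff
proof (intro allI impI)
  fix k :: nat
  assume "k < 2 ^ j"
  then obtain p where "degree p < r" "\<forall>y\<in>{0..<1}. f ((y + real k) / 2 ^ j) = poly p y"
    using assms unfolding V_space_iff by blast
  then show "\<exists>p. degree p < r \<and> (\<forall>y\<in>{0..<1}. c * f ((y + real k) / 2 ^ j) = poly p y)"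
    by (intro exI[of _ "Polynomial.smult c p"]) (auto intro: order_le_less_trans[OF degree_smult_le])
qed

lemma V_space_add:
  assumes "f \<in> V_space r j" "g \<in> V_space r j"
  shows "(\<lambda>x. f x + g x) \<in> V_space r j"
  unfolding V_space_iff
proof (intro allI impI)
  fix k :: nat
  assume k: "k < 2 ^ j"
  obtain p where "degree p < r" "\<forall>y\<in>{0..<1}. f ((y + real k) / 2 ^ j) = poly p y"
    using assms(1) k unfolding V_space_iff by blast
  moreover obtain q where "degree q < r" "\<forall>y\<in>{0..<1}. g ((y + real k) / 2 ^ j) = poly q y"
    using assms(2) k unfolding V_space_iff by blast
  ultimately show "\<exists>p. degree p < r \<and> (\<forall>y\<in>{0..<1}. f ((y + real k) / 2 ^ j) + g ((y + real k) / 2 ^ j) = poly p y)"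
    by (intro exI[of _ "p + q"]) (auto intro: degree_add_less)
qed

lemma V_space_diff:
  assumes "f \<in> V_space r j" "g \<in> V_space r j"
  shows "(\<lambda>x. f x - g x) \<in> V_space r j"
  using V_space_add[OF assms(1) V_space_cmult[OF assms(2), of "-1"]] by simp

lemma V_space_zero: "0 < r \<Longrightarrow> (\<lambda>x. 0) \<in> V_space r j"
  unfolding V_space_iff by (auto intro!: exI[of _ 0])

lemma V_space_lincomb:
  assumes "0 < r" "\<And>i. i \<in> I \<Longrightarrow> f i \<in> V_space r j"
  shows "(\<lambda>x. \<Sum>i\<in>I. c i * f i x) \<in> V_space r j"
  using assms(2)
proof (induction I rule: infinite_finite_induct)
  case (insert i I)
  then have "(\<lambda>x. c i * f i x) \<in> V_space r j" "(\<lambda>x. \<Sum>i\<in>I. c i * f i x) \<in> V_space r j"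
    by (auto intro: V_space_cmult)
  then show ?case
    using insert.hyps V_space_add by force
qed (simp_all add: V_space_zero assms(1))

text \<open>Cell \<open>m\<close> of level \<open>i\<close> inside coarse cell \<open>k\<close> of
  level \<open>j\<close> is cell \<open>m + k * 2 ^ i\<close> of level \<open>i + j\<close>.\<close>

lemma V_space_contract:
  assumes f: "f \<in> V_space r (i + j)" and k: "k < 2 ^ j"
  shows "(\<lambda>y. f ((y + real k) / 2 ^ j)) \<in> V_space r i"
  unfolding V_space_iff
proof (intro allI impI)
  fix m :: nat
  assume m: "m < 2 ^ i"
  have "m + k * 2 ^ i < 2 ^ i * Suc k"
    using m by simp
  also have "\<dots> \<le> 2 ^ i * 2 ^ j"
    using k by (intro mult_le_mono2) simp
  finally have "m + k * 2 ^ i < 2 ^ (i + j)"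
    by (simp add: power_add)
  then obtain p where "degree p < r" "\<forall>y\<in>{0..<1}. f ((y + real (m + k * 2 ^ i)) / 2 ^ (i + j)) = poly p y"
    using f unfolding V_space_iff by blast
  moreover have "(y + real (m + k * 2 ^ i)) / 2 ^ (i + j) = ((y + real m) / 2 ^ i + real k) / 2 ^ j" for y
    by (simp add: power_add field_simps)
  ultimately show "\<exists>p. degree p < r \<and> (\<forall>y\<in>{0..<1}. f (((y + real m) / 2 ^ i + real k) / 2 ^ j) = poly p y)"
    by auto
qed

text \<open>Here \<open>k\<close> is the coarse cell that contains the fine cell \<open>m\<close>,
  and \<open>b\<close> is the position of \<open>m\<close> inside it.\<close>

lemma dyadic_split:
  fixes m i j :: nat
  assumes "m < 2 ^ (i + j)"
  obtains b k where "m = b + k * 2 ^ i" "b < 2 ^ i" "k < 2 ^ j"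
proof
  show "m = m mod 2 ^ i + m div 2 ^ i * 2 ^ i"
    by (rule mod_div_mult_eq[symmetric])
  show "m mod 2 ^ i < 2 ^ i"
    by simp
  show "m div 2 ^ i < 2 ^ j"
    using assms by (simp add: less_mult_imp_div_less power_add mult.commute)
qed

lemma dyadic_offset_unit:
  assumes "b < (2::nat) ^ i" "y \<in> {0..<1}"
  shows "(y + real b) / 2 ^ i \<in> {0..<1}"
proof -
  have "real (Suc b) \<le> 2 ^ i"
    using assms(1) by (metis Suc_leI of_nat_le_iff of_nat_numeral of_nat_power)
  then show ?thesis
    using assms(2) by (simp add: divide_less_eq)
qed

text \<open>On fine cells inside coarse cell \<open>k\<close> the dilate shows a piece of
  \<open>f\<close>. On all others its argument falls outside \<open>{0..<1}\<close>, where
  \<open>f\<close> is 0, and the zero polynomial is admissible because \<open>0 < r\<close>.\<close>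

lemma V_space_dilate:
  assumes r: "0 < r" and f: "f \<in> V_space r i" and zero: "\<And>x. x \<notin> {0..<1} \<Longrightarrow> f x = 0"
  shows "(\<lambda>x. f (2 ^ j * x - real k)) \<in> V_space r (i + j)"
  unfolding V_space_iff
proof (intro allI impI)
  fix m :: nat
  assume m: "m < 2 ^ (i + j)"
  obtain b k' where b: "m = b + k' * 2 ^ i" "b < 2 ^ i"
    using dyadic_split[OF m] by blast
  have eq: "2 ^ j * ((y + real m) / 2 ^ (i + j)) - real k = (y + real b) / 2 ^ i + (real k' - real k)" for y
    by (simp add: b(1) power_add field_simps)
  show "\<exists>p. degree p < r \<and> (\<forall>y\<in>{0..<1}. f (2 ^ j * ((y + real m) / 2 ^ (i + j)) - real k) = poly p y)"
  proof (cases "k' = k")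
    case True
    then show ?thesis
      using f b(2) unfolding V_space_iff eq by simp
  next
    case False
    have "f ((y + real b) / 2 ^ i + (real k' - real k)) = 0" if "y \<in> {0..<1}" for y
    proof (rule zero)
      have "real k' - real k \<le> -1 \<or> real k' - real k \<ge> 1"
        using False by linarith
      then show "(y + real b) / 2 ^ i + (real k' - real k) \<notin> {0..<1}"
        using dyadic_offset_unit[OF b(2) that] unfolding atLeastLessThan_iff by linarith
    qed
    then show ?thesis
      using r unfolding eq by (intro exI[of _ 0]) simp
  qed
qed

lemma V_space_mono: "i \<le> j \<Longrightarrow> V_space r i \<subseteq> V_space r j"
proof (rule lift_Suc_mono_le[of "V_space r"])
  fix n
  show "V_space r n \<subseteq> V_space r (Suc n)"
  proof
    fix f
    assume f: "f \<in> V_space r n"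
    show "f \<in> V_space r (Suc n)"
      unfolding V_space_iff
    proof (intro allI impI)
      fix m :: nat
      assume "m < 2 ^ Suc n"
      then have "m < 2 ^ (1 + n)"
        by simp
      \<comment> \<open>Cell \<open>m\<close> is the left or right half (\<open>b\<close> is 0 or 1)
        of its parent \<open>k\<close>, and inherits the parent's polynomial.\<close>
      then obtain b k where b: "m = b + k * 2 ^ 1" "b < 2 ^ 1" "k < 2 ^ n"
        by (rule dyadic_split)
      obtain p where p: "degree p < r" "\<forall>y\<in>{0..<1}. f ((y + real k) / 2 ^ n) = poly p y"
        using f b(3) unfolding V_space_iff by blast
      have "f ((y + real m) / 2 ^ Suc n) = poly (p \<circ>\<^sub>p [:real b / 2, 1 / 2:]) y" if "y \<in> {0..<1}" for y
      proof -
        have "f (((y + real b) / 2 ^ 1 + real k) / 2 ^ n) = poly p ((y + real b) / 2 ^ 1)"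
          using p(2) dyadic_offset_unit[OF b(2) that] by blast
        moreover have "((y + real b) / 2 ^ 1 + real k) / 2 ^ n = (y + real m) / 2 ^ Suc n"
          by (simp add: b(1) field_simps)
        moreover have "poly (p \<circ>\<^sub>p [:real b / 2, 1 / 2:]) y = poly p ((y + real b) / 2 ^ 1)"
          by (simp add: poly_pcompose add_divide_distrib add.commute)
        ultimately show ?thesis
          by simp
      qed
      then show "\<exists>p. degree p < r \<and> (\<forall>y\<in>{0..<1}. f ((y + real m) / 2 ^ Suc n) = poly p y)"
        using p(1) by (intro exI[of _ "p \<circ>\<^sub>p [:real b / 2, 1 / 2:]"]) (simp add: degree_pcompose)
    qed
  qed
qed

lemma phi_V_space:
  assumes "l < r"
  shows "phi l \<in> V_space r 0"
  unfolding V_space_iff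
proof (intro allI impI)
  fix k :: nat
  assume "k < 2 ^ 0"
  then show "\<exists>p. degree p < r \<and> (\<forall>y\<in>{0..<1}. phi l ((y + real k) / 2 ^ 0) = poly p y)"
    using assms
    by (intro exI[of _ "Polynomial.smult (sqrt (2 * real l + 1)) (legendre l \<circ>\<^sub>p [:-1, 2:])"])
      (auto simp: phi_def poly_pcompose degree_pcompose degree_legendre mult.commute)
qed

lemma L2_inner_dilate:
  assumes zero: "\<And>x. x \<notin> {0..<1} \<Longrightarrow> f x = 0" and k: "k < (2::nat) ^ j"
  shows "L2_inner (\<lambda>x. f (2 ^ j * x - real k)) g = L2_inner f (\<lambda>y. g ((y + real k) / 2 ^ j)) / 2 ^ j"
proof -
  have k': "real (Suc k) \<le> 2 ^ j"
    using k by (metis Suc_leI of_nat_le_iff of_nat_numeral of_nat_power)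
  have "L2_inner (\<lambda>x. f (2 ^ j * x - real k)) g = (LBINT x. f (2 ^ j * x - real k) * g x)"
    unfolding L2_inner_def set_lebesgue_integral_def
  proof (rule Bochner_Integration.integral_cong)
    fix x :: real
    show "indicat_real {0..1} x *\<^sub>R (f (2 ^ j * x - real k) * g x) = f (2 ^ j * x - real k) * g x"
    proof (cases "2 ^ j * x - real k \<in> {0..<1}")
      case True
      then have "0 \<le> 2 ^ j * x" "2 ^ j * x \<le> 2 ^ j"
        using k' unfolding atLeastLessThan_iff by linarith+
      then have "x \<in> {0..1}"
        using zero_less_power[of "2::real" j] by (auto simp: zero_le_mult_iff simp del: zero_less_power)
      then show ?thesis
        by simp
    qed (simp add: zero)
  qed simp
  also have "\<dots> = \<bar>1 / 2 ^ j\<bar> *\<^sub>R (LBINT y. f (2 ^ j * (real k / 2 ^ j + 1 / 2 ^ j * y) - real k) * g (real k / 2 ^ j + 1 / 2 ^ j * y))"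
    by (rule lborel_integral_real_affine) simp
  also have "\<dots> = (LBINT y. f y * g ((y + real k) / 2 ^ j)) / 2 ^ j"
    by (simp add: field_simps)
  also have "(LBINT y. f y * g ((y + real k) / 2 ^ j)) = L2_inner f (\<lambda>y. g ((y + real k) / 2 ^ j))"
    unfolding L2_inner_def set_lebesgue_integral_def
  proof (rule Bochner_Integration.integral_cong)
    fix y :: real
    show "f y * g ((y + real k) / 2 ^ j) = indicat_real {0..1} y *\<^sub>R (f y * g ((y + real k) / 2 ^ j))"
      by (cases "y \<in> {0..<1}") (simp_all add: zero)
  qed simp
  finally show ?thesis .
qed

text \<open>\<open>P\<close> need not be measurable, so the transfer is made for the complement of a
  Borel null set that contains all exceptions.\<close>

lemma AE_lborel_affine:
  fixes c :: real
  assumes "c \<noteq> 0" "AE x in lborel. P x"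
  shows "AE x in lborel. P (t + c * x)"
proof -
  obtain N where N: "{x. \<not> P x} \<subseteq> N" "N \<in> null_sets lborel"
    using assms(2) unfolding eventually_ae_filter by auto
  have [measurable]: "N \<in> sets borel"
    using N(2) by auto
  have "AE x in lborel. x \<notin> N"
    by (rule AE_not_in[OF N(2)])
  then have "AE x in lborel. t + c * x \<notin> N"
    by (intro AE_borel_affine[where P = "\<lambda>x. x \<notin> N"] assms(1)) measurable
  then show ?thesis
    using N(1) by (auto elim: eventually_mono)
qed

section \<open>The multiwavelet basis\<close>

context
  fixes r :: nat and \<psi> :: "nat \<Rightarrow> real \<Rightarrow> real"
  assumes r: "0 < r"
    and psi_basis: "orthonormal_basis_of (W0_space r) r \<psi>"
    and psi_zero: "\<And>l x. l < r \<Longrightarrow> x \<notin> {0..<1} \<Longrightarrow> \<psi> l x = 0"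
begin

section \<open>Orthonormality of scaling functions and wavelets\<close>

lemma psi_V_space: "l < r \<Longrightarrow> \<psi> l \<in> V_space r 1"
  using psi_basis by (auto simp: orthonormal_basis_of_def W0_space_def orth_complement_in_def)

lemma psi_orthogonal_V_space: "l < r \<Longrightarrow> g \<in> V_space r 0 \<Longrightarrow> L2_inner (\<psi> l) g = 0"
  using psi_basis by (auto simp: orthonormal_basis_of_def W0_space_def orth_complement_in_def)

lemma psi_orthonormal: "l < r \<Longrightarrow> l' < r \<Longrightarrow> L2_inner (\<psi> l) (\<psi> l') = (if l = l' then 1 else 0)"
  using psi_basis by (simp add: orthonormal_basis_of_def)

lemma psi_scaled_V_space:
  assumes "l < r"
  shows "psi_scaled \<psi> j k l \<in> V_space r (Suc j)"
proof -
  have "(\<lambda>x. \<psi> l (2 ^ j * x - real k)) \<in> V_space r (1 + j)"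
    using r psi_V_space[OF assms] psi_zero[OF assms] by (rule V_space_dilate)
  then show ?thesis
    using V_space_cmult[of "\<lambda>x. \<psi> l (2 ^ j * x - real k)" r "1 + j" "2 powr (real j / 2)"]
    by (simp add: psi_scaled_def[abs_def])
qed

lemma L2_inner_psi_scaled:
  assumes "l < r" "k < 2 ^ j"
  shows "L2_inner (psi_scaled \<psi> j k l) g
    = 2 powr (real j / 2) / 2 ^ j * L2_inner (\<psi> l) (\<lambda>y. g ((y + real k) / 2 ^ j))"
  using L2_inner_dilate[of "\<psi> l" k j g] psi_zero[OF assms(1)] assms(2)
  by (simp add: psi_scaled_def[abs_def] L2_inner_cmult_left)

lemma psi_scaled_orthogonal_V_space:
  assumes "l < r" "k < 2 ^ j" "g \<in> V_space r j"
  shows "L2_inner (psi_scaled \<psi> j k l) g = 0"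
  using V_space_contract[of g r 0 j k] assms by (simp add: L2_inner_psi_scaled psi_orthogonal_V_space)

text \<open>Pulled back to cell \<open>k\<close>, the second wavelet is a multiple of
  \<open>\<psi> l'\<close> if \<open>k = k'\<close>; otherwise it is shifted by a nonzero integer
  and vanishes where \<open>\<psi> l\<close> lives. The two factors 2^(j/2) cancel the Jacobian
  2^(-j).\<close>

lemma psi_scaled_orthonormal_level:
  assumes l: "l < r" "l' < r" and k: "k < 2 ^ j" "k' < 2 ^ j"
  shows "L2_inner (psi_scaled \<psi> j k l) (psi_scaled \<psi> j k' l') = (if (k, l) = (k', l') then 1 else 0)"
proof -
  let ?s = "2 powr (real j / 2) :: real"
  have "?s * ?s = 2 ^ j"
    by (simp add: powr_add[symmetric] powr_realpow)
  have "L2_inner (\<psi> l) (\<lambda>y. psi_scaled \<psi> j k' l' ((y + real k) / 2 ^ j))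
      = L2_inner (\<lambda>y. ?s * (if k = k' then 1 else 0) * \<psi> l' y) (\<psi> l)"
    unfolding L2_inner_def
  proof (rule set_lebesgue_integral_cong)
    show "\<forall>y. y \<in> {0..1} \<longrightarrow> \<psi> l y * psi_scaled \<psi> j k' l' ((y + real k) / 2 ^ j)
      = ?s * (if k = k' then 1 else 0) * \<psi> l' y * \<psi> l y"
    proof (intro allI impI)
      fix y :: real
      have "\<psi> l y * \<psi> l' (y + (real k - real k')) = (if k = k' then 1 else 0) * \<psi> l' y * \<psi> l y"
      proof (cases "k = k' \<or> y \<notin> {0..<1}")
        case True
        then show ?thesis
          using psi_zero[OF l(1)] by auto
      next
        case False
        then have "real k - real k' \<le> -1 \<or> real k - real k' \<ge> 1"
          by linarith
        then have "y + (real k - real k') \<notin> {0..<1}"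
          using False by auto
        then show ?thesis
          using psi_zero[OF l(2)] False by simp
      qed
      then show "\<psi> l y * psi_scaled \<psi> j k' l' ((y + real k) / 2 ^ j)
        = ?s * (if k = k' then 1 else 0) * \<psi> l' y * \<psi> l y"
        by (simp add: psi_scaled_def add_diff_eq)
    qed
  qed simp
  also have "\<dots> = ?s * (if k = k' then 1 else 0) * (if l = l' then 1 else 0)"
    unfolding L2_inner_cmult_left using l by (auto simp: psi_orthonormal)
  finally have "L2_inner (psi_scaled \<psi> j k l) (psi_scaled \<psi> j k' l')
      = ?s / 2 ^ j * (?s * (if k = k' then 1 else 0) * (if l = l' then 1 else 0))"
    using l k by (simp only: L2_inner_psi_scaled)
  then show ?thesis
    using \<open>?s * ?s = 2 ^ j\<close> by simp
qed

text \<open>For different levels the coarser wavelet already belongs to the space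
  \<open>V_space r\<close> at the finer level, and the finer wavelet is orthogonal to that
  space.\<close>

lemma psi_scaled_orthonormal:
  assumes l: "l < r" "l' < r" and k: "k < 2 ^ j" "k' < 2 ^ j'"
  shows "L2_inner (psi_scaled \<psi> j k l) (psi_scaled \<psi> j' k' l') = (if (j, k, l) = (j', k', l') then 1 else 0)"
proof (cases j j' rule: linorder_cases)
  case less
  then have "psi_scaled \<psi> j k l \<in> V_space r j'"
    using V_space_mono[of "Suc j" j' r] psi_scaled_V_space[OF l(1)] by auto
  then show ?thesis
    using less psi_scaled_orthogonal_V_space[OF l(2) k(2)] by (simp add: L2_inner_commute)
next
  case equal
  then show ?thesis
    using psi_scaled_orthonormal_level[OF l] k by simp
next
  case greater
  then have "psi_scaled \<psi> j' k' l' \<in> V_space r j"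
    using V_space_mono[of "Suc j'" j r] psi_scaled_V_space[OF l(2)] by auto
  then show ?thesis
    using greater psi_scaled_orthogonal_V_space[OF l(1) k(1)] by simp
qed

lemma phi_psi_scaled_orthogonal:
  assumes "l < r" "l' < r" "k < 2 ^ j"
  shows "L2_inner (psi_scaled \<psi> j k l') (phi l) = 0"
  using V_space_mono[of 0 j r] phi_V_space[OF assms(1)] psi_scaled_orthogonal_V_space[OF assms(2,3)] by auto

text \<open>Subtracting the Fourier sum in \<open>phi\<close> leaves a remainder in V_1 orthogonal
  to each \<open>phi l\<close>, hence to V_0, which these span almost everywhere. That is membership
  in \<open>W0_space\<close>, where \<open>\<psi>\<close> is a basis.\<close>

lemma V_space_one_decomposition:
  assumes f: "f \<in> V_space r 1"
  obtains c d :: "nat \<Rightarrow> real"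
    where "L2_eq f (\<lambda>x. (\<Sum>l<r. c l * phi l x) + (\<Sum>l<r. d l * \<psi> l x))"
proof -
  define c where "c l = L2_inner f (phi l)" for l
  let ?p = "\<lambda>x. \<Sum>l<r. c l * phi l x"
  have f2: "f \<in> L2_unit"
    using f V_space_L2_unit by blast
  have p2: "?p \<in> L2_unit"
    by (intro L2_unit_lincomb phi_L2_unit)
  have "?p \<in> V_space r 0"
    using r by (intro V_space_lincomb) (auto intro: phi_V_space)
  then have "?p \<in> V_space r 1"
    using V_space_mono[of 0 1 r] by auto
  then have d1: "(\<lambda>x. f x - ?p x) \<in> V_space r 1"
    by (intro V_space_diff f)
  then have d2: "(\<lambda>x. f x - ?p x) \<in> L2_unit"
    using V_space_L2_unit by blast
  have orth_phi: "L2_inner (phi l) (\<lambda>x. f x - ?p x) = 0" if "l < r" for l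
    using L2_inner_diff_left[OF f2 p2 phi_L2_unit[of l]]
      L2_inner_orthonormal_lincomb[of r phi l c] that phi_L2_unit phi_orthonormal
    by (simp add: L2_inner_commute[of "phi l"] c_def)
  have "L2_inner (\<lambda>x. f x - ?p x) g = 0" if g: "g \<in> V_space r 0" for g
  proof -
    obtain p where p: "degree p < r" "\<forall>x\<in>{0..<1}. g x = poly p x"
      using g unfolding V_space_iff by auto
    obtain a where "\<forall>x\<in>{0..<1}. poly p x = (\<Sum>l<r. a l * phi l x)"
      using phi_span[OF p(1)] by blast
    with p(2) have "L2_eq g (\<lambda>x. \<Sum>l<r. a l * phi l x)"
      unfolding L2_eq_def using AE_unit_interval_half_open by (auto elim: eventually_mono)
    then have "L2_inner g (\<lambda>x. f x - ?p x) = L2_inner (\<lambda>x. \<Sum>l<r. a l * phi l x) (\<lambda>x. f x - ?p x)"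
      using g V_space_L2_unit by (intro L2_inner_cong_left L2_unit_lincomb phi_L2_unit d2) auto
    also have "\<dots> = 0"
      using orth_phi by (subst L2_inner_lincomb_left) (auto intro: d2 phi_L2_unit)
    finally show ?thesis
      by (simp add: L2_inner_commute)
  qed
  then have "(\<lambda>x. f x - ?p x) \<in> W0_space r"
    using d1 by (simp add: W0_space_def orth_complement_in_def)
  then obtain d :: "nat \<Rightarrow> real" where "L2_eq (\<lambda>x. f x - ?p x) (\<lambda>x. \<Sum>l<r. d l * \<psi> l x)"
    using psi_basis unfolding orthonormal_basis_of_def by blast
  then have "L2_eq f (\<lambda>x. ?p x + (\<Sum>l<r. d l * \<psi> l x))"
    unfolding L2_eq_def by eventually_elim auto
  then show ?thesis
    by (rule that)
qed

section \<open>Completeness of the multiwavelet system\<close>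

lemma sum_wavelet_index_Suc:
  fixes F :: "nat \<times> nat \<times> nat \<Rightarrow> real"
  shows "(\<Sum>t\<in>wavelet_index r (Suc J). F t)
    = (\<Sum>t\<in>wavelet_index r J. F t) + (\<Sum>k<2 ^ J. \<Sum>l<r. F (J, k, l))"
proof -
  let ?A = "(\<lambda>(k, l). (J, k, l)) ` ({..<2 ^ J} \<times> {..<r})"
  have "wavelet_index r J \<subseteq> {..<J} \<times> {..<2 ^ J} \<times> {..<r}"
    by (auto simp: wavelet_index_def intro: less_le_trans power_increasing)
  then have fin: "finite (wavelet_index r J)"
    by (rule finite_subset) simp
  have "wavelet_index r (Suc J) = wavelet_index r J \<union> ?A"
    by (auto simp: wavelet_index_def less_Suc_eq image_iff)
  moreover have "wavelet_index r J \<inter> ?A = {}"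
    by (auto simp: wavelet_index_def)
  ultimately have "(\<Sum>t\<in>wavelet_index r (Suc J). F t) = (\<Sum>t\<in>wavelet_index r J. F t) + (\<Sum>t\<in>?A. F t)"
    using fin by (simp add: sum.union_disjoint)
  also have "(\<Sum>t\<in>?A. F t) = (\<Sum>(k, l)\<in>{..<2 ^ J} \<times> {..<r}. F (J, k, l))"
    by (subst sum.reindex) (auto simp: inj_on_def intro!: sum.cong)
  finally show ?thesis
    by (simp add: sum.cartesian_product)
qed

lemma V_space_span:
  assumes "f \<in> V_space r J"
  shows "\<exists>a d. L2_eq f (\<lambda>x. (\<Sum>l<r. a l * phi l x)
    + (\<Sum>t\<in>wavelet_index r J. d t * (case t of (j, k, l) \<Rightarrow> psi_scaled \<psi> j k l x)))"
  using assms
proof (induction J arbitrary: f)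
  case 0
  obtain p where p: "degree p < r" "\<forall>x\<in>{0..<1}. f x = poly p x"
    using 0 unfolding V_space_iff by auto
  obtain a where "\<forall>x\<in>{0..<1}. poly p x = (\<Sum>l<r. a l * phi l x)"
    using phi_span[OF p(1)] by blast
  with p(2) have "L2_eq f (\<lambda>x. \<Sum>l<r. a l * phi l x)"
    unfolding L2_eq_def using AE_unit_interval_half_open by (auto elim: eventually_mono)
  moreover have "wavelet_index r 0 = {}"
    by (simp add: wavelet_index_def)
  ultimately show ?case
    by auto
next
  case (Suc J)
  \<comment> \<open>The guard on \<open>k\<close> sits inside the existentials so that
    \<open>choice_iff\<close> yields coefficient families indexed by all naturals.\<close>
  have "\<exists>c d. k < 2 ^ J \<longrightarrow> L2_eq (\<lambda>y. f ((y + real k) / 2 ^ J))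
      (\<lambda>x. (\<Sum>l<r. c l * phi l x) + (\<Sum>l<r. d l * \<psi> l x))" for k
  proof (cases "k < 2 ^ J")
    case True
    have "(\<lambda>y. f ((y + real k) / 2 ^ J)) \<in> V_space r 1"
      using V_space_contract[of f r 1 J k] Suc.prems True by simp
    then obtain c d where "L2_eq (\<lambda>y. f ((y + real k) / 2 ^ J))
        (\<lambda>x. (\<Sum>l<r. c l * phi l x) + (\<Sum>l<r. d l * \<psi> l x))"
      by (rule V_space_one_decomposition)
    then show ?thesis
      by blast
  qed simp
  then have "\<forall>k. \<exists>c d. k < 2 ^ J \<longrightarrow> L2_eq (\<lambda>y. f ((y + real k) / 2 ^ J))
      (\<lambda>x. (\<Sum>l<r. c l * phi l x) + (\<Sum>l<r. d l * \<psi> l x))"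
    by blast
  then have "\<exists>c d. \<forall>k. k < 2 ^ J \<longrightarrow> L2_eq (\<lambda>y. f ((y + real k) / 2 ^ J))
      (\<lambda>x. (\<Sum>l<r. c k l * phi l x) + (\<Sum>l<r. d k l * \<psi> l x))"
    unfolding choice_iff .
  then obtain c d where cd: "\<And>k. k < 2 ^ J \<Longrightarrow> L2_eq (\<lambda>y. f ((y + real k) / 2 ^ J))
      (\<lambda>x. (\<Sum>l<r. c k l * phi l x) + (\<Sum>l<r. d k l * \<psi> l x))"
    by blast
  \<comment> \<open>The V_0-parts of all cells glued together; the factor 1 gives the sum the shape
    expected by \<open>V_space_lincomb\<close>.\<close>
  define g where "g x = (\<Sum>k<2 ^ J. 1 * (\<Sum>l<r. c k l * phi l (2 ^ J * x - real k)))" for x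
  have phi_zero: "phi l x = 0" if "x \<notin> {0..<1}" for l x
    using that by (auto simp: phi_def)
  have "(\<lambda>x. phi l (2 ^ J * x - real k)) \<in> V_space r J" if "l < r" for l k
    using V_space_dilate[OF r phi_V_space[OF that] phi_zero, of J k] by simp
  then have "g \<in> V_space r J"
    unfolding g_def using r by (intro V_space_lincomb) auto
  then obtain a e where ae: "L2_eq g (\<lambda>x. (\<Sum>l<r. a l * phi l x)
    + (\<Sum>t\<in>wavelet_index r J. e t * (case t of (j, k, l) \<Rightarrow> psi_scaled \<psi> j k l x)))"
    using Suc.IH by blast
  \<comment> \<open>Dividing by 2^(J/2) undoes the normalisation in \<open>psi_scaled\<close> for
    the new level.\<close>
  define D where "D = (\<lambda>(j, k, l). if j < J then e (j, k, l) else d k l / 2 powr (real J / 2))"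
  have D: "(\<Sum>t\<in>wavelet_index r (Suc J). D t * (case t of (j, k, l) \<Rightarrow> psi_scaled \<psi> j k l x))
    = (\<Sum>t\<in>wavelet_index r J. e t * (case t of (j, k, l) \<Rightarrow> psi_scaled \<psi> j k l x))
      + (\<Sum>k<2 ^ J. \<Sum>l<r. d k l * \<psi> l (2 ^ J * x - real k))" for x
    unfolding sum_wavelet_index_Suc
    by (intro arg_cong2[where f = "(+)"] sum.cong) (auto simp: D_def wavelet_index_def psi_scaled_def)
  have "AE x in lborel. x \<in> {0..1} \<longrightarrow>
      f x = g x + (\<Sum>k<2 ^ J. \<Sum>l<r. d k l * \<psi> l (2 ^ J * x - real k))"
  proof -
    \<comment> \<open>There are finitely many cells, so the exceptional null sets, carried over by
      affine maps, can be united.\<close>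
    have "AE x in lborel. \<forall>k\<in>{..<2 ^ J}. 2 ^ J * x - real k \<in> {0..1} \<longrightarrow>
      f x = (\<Sum>l<r. c k l * phi l (2 ^ J * x - real k)) + (\<Sum>l<r. d k l * \<psi> l (2 ^ J * x - real k))"
    proof (rule AE_finite_allI)
      fix k :: nat
      assume "k \<in> {..<2 ^ J}"
      then have "AE y in lborel. y \<in> {0..1} \<longrightarrow> f ((y + real k) / 2 ^ J)
          = (\<Sum>l<r. c k l * phi l y) + (\<Sum>l<r. d k l * \<psi> l y)"
        using cd unfolding L2_eq_def by auto
      then have "AE x in lborel. - real k + 2 ^ J * x \<in> {0..1} \<longrightarrow> f ((- real k + 2 ^ J * x + real k) / 2 ^ J)
          = (\<Sum>l<r. c k l * phi l (- real k + 2 ^ J * x)) + (\<Sum>l<r. d k l * \<psi> l (- real k + 2 ^ J * x))"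
        by (rule AE_lborel_affine[rotated]) simp
      moreover have "- real k + 2 ^ J * x = 2 ^ J * x - real k" for x
        by simp
      ultimately show "AE x in lborel. 2 ^ J * x - real k \<in> {0..1} \<longrightarrow>
        f x = (\<Sum>l<r. c k l * phi l (2 ^ J * x - real k)) + (\<Sum>l<r. d k l * \<psi> l (2 ^ J * x - real k))"
        by simp
    qed simp
    then show ?thesis
      using AE_unit_interval_half_open
    proof eventually_elim
      case (elim x)
      show ?case
      proof
        assume "x \<in> {0..1}"
        then have "x \<in> {0..<1}"
          using elim(2) by blast
        then obtain k0 where k0: "k0 < 2 ^ J" "\<And>k::nat. 2 ^ J * x - real k \<in> {0..<1} \<longleftrightarrow> k = k0"
          using dyadic_index[of x J] by blast
        have pick: "(\<Sum>k<2 ^ J. G k) = G k0" if "\<And>k. k \<noteq> k0 \<Longrightarrow> G k = 0" for G :: "nat \<Rightarrow> real"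
          using k0(1) that by (subst sum.remove[of _ k0]) (auto intro!: sum.neutral)
        have off: "2 ^ J * x - real k \<notin> {0..<1}" if "k \<noteq> k0" for k
          using k0(2) that by blast
        have "g x = (\<Sum>l<r. c k0 l * phi l (2 ^ J * x - real k0))"
          unfolding g_def by (subst pick) (simp_all add: phi_zero[OF off])
        moreover have "(\<Sum>k<2 ^ J. \<Sum>l<r. d k l * \<psi> l (2 ^ J * x - real k))
            = (\<Sum>l<r. d k0 l * \<psi> l (2 ^ J * x - real k0))"
          by (subst pick) (auto intro!: sum.neutral simp: psi_zero[OF _ off])
        moreover have "2 ^ J * x - real k0 \<in> {0..1}"
          using k0(2)[of k0] by auto
        ultimately show "f x = g x + (\<Sum>k<2 ^ J. \<Sum>l<r. d k l * \<psi> l (2 ^ J * x - real k))"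
          using elim(1) k0(1) by auto
      qed
    qed
  qed
  then have "L2_eq f (\<lambda>x. (\<Sum>l<r. a l * phi l x)
    + (\<Sum>t\<in>wavelet_index r (Suc J). D t * (case t of (j, k, l) \<Rightarrow> psi_scaled \<psi> j k l x)))"
    using ae unfolding L2_eq_def D by eventually_elim auto
  then show ?case
    by blast
qed

text \<open>Injectivity of \<open>e\<close> gives orthonormality, since distinct positions carry
  distinct triples; surjectivity gives completeness, by reindexing the sum in
  \<open>V_space_span\<close>.\<close>

lemma psi_bar_orthonormal_basis:
  assumes enum: "bij_betw e {r..<r * 2 ^ J} (wavelet_index r J)"
  shows "orthonormal_basis_of (V_space r J) (r * 2 ^ J) (psi_bar r \<psi> e)"
proof -
  let ?N = "r * 2 ^ J"
  have e: "e i \<in> wavelet_index r J" if "r \<le> i" "i < ?N" for i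
    using bij_betwE[OF enum] that by auto
  have einj: "e i = e i' \<longleftrightarrow> i = i'" if "r \<le> i" "i < ?N" "r \<le> i'" "i' < ?N" for i i'
    using bij_betw_imp_inj_on[OF enum] that by (auto simp: inj_on_def)
  have mem: "psi_bar r \<psi> e i \<in> V_space r J" if i: "i < ?N" for i
  proof (cases "i < r")
    case True
    then show ?thesis
      using phi_V_space[OF True] V_space_mono[of 0 J r] by (auto simp: psi_bar_def[abs_def])
  next
    case False
    obtain j k l where t: "e i = (j, k, l)"
      by (rule prod_cases3)
    then have "j < J" "l < r"
      using e[of i] False i by (auto simp: wavelet_index_def)
    then show ?thesis
      using False t psi_scaled_V_space[of l j k] V_space_mono[of "Suc j" J r] by (auto simp: psi_bar_def[abs_def])
  qed
  have orth: "L2_inner (psi_bar r \<psi> e i) (psi_bar r \<psi> e i') = (if i = i' then 1 else 0)"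
    if i: "i < ?N" "i' < ?N" for i i'
  proof -
    obtain j k l where t: "e i = (j, k, l)"
      by (rule prod_cases3)
    obtain j' k' l' where t': "e i' = (j', k', l')"
      by (rule prod_cases3)
    have w: "k < 2 ^ j" "l < r" if "\<not> i < r"
      using e[of i] that i t by (auto simp: wavelet_index_def)
    have w': "k' < 2 ^ j'" "l' < r" if "\<not> i' < r"
      using e[of i'] that i t' by (auto simp: wavelet_index_def)
    have b: "psi_bar r \<psi> e i = (if i < r then phi i else psi_scaled \<psi> j k l)"
      "psi_bar r \<psi> e i' = (if i' < r then phi i' else psi_scaled \<psi> j' k' l')"
      by (auto simp: psi_bar_def t t')
    show ?thesis
    proof (cases "i < r"; cases "i' < r")
      assume "i < r" "i' < r"
      then show ?thesis
        by (simp add: b phi_orthonormal)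
    next
      assume "i < r" "\<not> i' < r"
      then show ?thesis
        using w' by (auto simp: b phi_psi_scaled_orthogonal L2_inner_commute[of "phi i"])
    next
      assume "\<not> i < r" "i' < r"
      then show ?thesis
        using w by (auto simp: b phi_psi_scaled_orthogonal)
    next
      assume "\<not> i < r" "\<not> i' < r"
      then show ?thesis
        using w w' einj[of i i'] i psi_scaled_orthonormal[of l l' k j k' j'] by (auto simp: b t t')
    qed
  qed
  have span: "\<exists>c :: nat \<Rightarrow> real. L2_eq f (\<lambda>x. \<Sum>i<?N. c i * psi_bar r \<psi> e i x)" if f: "f \<in> V_space r J" for f
  proof -
    obtain a d where ad: "L2_eq f (\<lambda>x. (\<Sum>l<r. a l * phi l x)
      + (\<Sum>t\<in>wavelet_index r J. d t * (case t of (j, k, l) \<Rightarrow> psi_scaled \<psi> j k l x)))"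
      using V_space_span[OF f] by blast
    define c where "c i = (if i < r then a i else d (e i))" for i
    have "(\<Sum>i<?N. c i * psi_bar r \<psi> e i x) = (\<Sum>l<r. a l * phi l x)
      + (\<Sum>t\<in>wavelet_index r J. d t * (case t of (j, k, l) \<Rightarrow> psi_scaled \<psi> j k l x))" for x
    proof -
      have "(\<Sum>t\<in>wavelet_index r J. d t * (case t of (j, k, l) \<Rightarrow> psi_scaled \<psi> j k l x))
        = (\<Sum>i\<in>{r..<?N}. d (e i) * (case e i of (j, k, l) \<Rightarrow> psi_scaled \<psi> j k l x))"
        by (rule sum.reindex_bij_betw[OF enum, symmetric])
      also have "\<dots> = (\<Sum>i\<in>{r..<?N}. c i * psi_bar r \<psi> e i x)"
        by (rule sum.cong) (auto simp: c_def psi_bar_def split: prod.split)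
      finally have "(\<Sum>t\<in>wavelet_index r J. d t * (case t of (j, k, l) \<Rightarrow> psi_scaled \<psi> j k l x))
        = (\<Sum>i\<in>{r..<?N}. c i * psi_bar r \<psi> e i x)" .
      moreover have "(\<Sum>l<r. a l * phi l x) = (\<Sum>i\<in>{0..<r}. c i * psi_bar r \<psi> e i x)"
        by (rule sum.cong) (auto simp: c_def psi_bar_def)
      moreover have "(\<Sum>i\<in>{0..<r}. c i * psi_bar r \<psi> e i x) + (\<Sum>i\<in>{r..<?N}. c i * psi_bar r \<psi> e i x)
        = (\<Sum>i\<in>{0..<?N}. c i * psi_bar r \<psi> e i x)"
        by (rule sum.atLeastLessThan_concat) auto
      ultimately show ?thesis
        by (simp add: lessThan_atLeast0)
    qed
    with ad show ?thesis
      by (intro exI[of _ c]) (simp only:)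
  qed
  show ?thesis
    unfolding orthonormal_basis_of_def using mem orth span by blast
qed

end

section \<open>The integral operator and its matrix\<close>

text \<open>The Gaussian is largest at 0, so its prefactor is a bound. If the denominator is 0,
  division by zero makes both sides 0.\<close>

lemma kappa_bounded: "\<exists>C. \<forall>z. \<bar>kappa \<sigma> L U z \<tau>\<bar> \<le> C" if "0 \<le> \<tau>"
proof (intro exI allI)
  fix z
  have "exp (- ((theta L U * z)\<^sup>2 / (4 * c_sq \<sigma> * \<tau>))) \<le> 1"
    using that by (simp add: c_sq_def)
  then show "\<bar>kappa \<sigma> L U z \<tau>\<bar> \<le> \<bar>theta L U / sqrt (4 * pi * c_sq \<sigma> * \<tau>)\<bar>"
    unfolding kappa_def abs_mult by (intro mult_left_le) auto
qed

lemma kappa_measurable [measurable]: "(\<lambda>z. kappa \<sigma> L U z \<tau>) \<in> borel_measurable borel"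
  unfolding kappa_def by measurable

lemma kappa_shift_L2_unit:
  assumes "0 \<le> \<tau>"
  shows "(\<lambda>\<xi>. kappa \<sigma> L U (z - \<xi>) \<tau>) \<in> L2_unit"
proof -
  obtain C where "\<And>z. \<bar>kappa \<sigma> L U z \<tau>\<bar> \<le> C"
    using kappa_bounded[OF assms] by blast
  moreover have "set_borel_measurable lborel {0..1} (\<lambda>\<xi>. kappa \<sigma> L U (z - \<xi>) \<tau>)"
    unfolding set_borel_measurable_def by measurable
  ultimately show ?thesis
    by (intro L2_unit_bounded) auto
qed

text \<open>Each value of the operator is an inner product with a slice of the kernel, so linearity
  and independence of representatives are inherited pointwise from \<open>L2_inner\<close>.\<close>

lemma K_op_eq_L2_inner: "K_op \<sigma> L U \<tau> f z = L2_inner f (\<lambda>\<xi>. kappa \<sigma> L U (z - \<xi>) \<tau>)"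
  by (simp add: K_op_def L2_inner_def mult.commute)

lemma K_op_L2_unit:
  assumes f: "f \<in> L2_unit" and \<tau>: "0 \<le> \<tau>"
  shows "K_op \<sigma> L U \<tau> f \<in> L2_unit"
proof -
  obtain C where C: "\<And>z. \<bar>kappa \<sigma> L U z \<tau>\<bar> \<le> C"
    using kappa_bounded[OF \<tau>] by blast
  \<comment> \<open>The cut-off is Borel on the whole line, so the parameter integral is measurable
    in \<open>z\<close>; it is bounded by C times the L1 norm of \<open>f1\<close>.\<close>
  define f1 where "f1 = (\<lambda>\<xi>. indicat_real {0..1} \<xi> * f \<xi>)"
  have [measurable]: "f1 \<in> borel_measurable borel"
    unfolding f1_def by (rule L2_unit_measurable[OF f])
  have K: "K_op \<sigma> L U \<tau> f = (\<lambda>z. LBINT \<xi>. kappa \<sigma> L U (z - \<xi>) \<tau> * f1 \<xi>)"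
    by (simp add: K_op_def f1_def set_lebesgue_integral_def mult.left_commute)
  have "(\<lambda>z. LBINT \<xi>. kappa \<sigma> L U (z - \<xi>) \<tau> * f1 \<xi>) \<in> borel_measurable borel"
    by measurable
  then have "set_borel_measurable lborel {0..1} (K_op \<sigma> L U \<tau> f)"
    unfolding K set_borel_measurable_def by measurable
  moreover have "\<bar>K_op \<sigma> L U \<tau> f z\<bar> \<le> C * (LBINT \<xi>. \<bar>f1 \<xi>\<bar>)" for z
  proof -
    have int: "integrable lborel f1"
      using L2_unit_integrable[OF f] by (simp add: set_integrable_def f1_def)
    have "\<bar>LBINT \<xi>. kappa \<sigma> L U (z - \<xi>) \<tau> * f1 \<xi>\<bar> \<le> (LBINT \<xi>. \<bar>kappa \<sigma> L U (z - \<xi>) \<tau> * f1 \<xi>\<bar>)"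
      by (rule integral_abs_bound)
    also have "\<dots> \<le> (LBINT \<xi>. C * \<bar>f1 \<xi>\<bar>)"
    proof (rule integral_mono')
      show "integrable lborel (\<lambda>\<xi>. C * \<bar>f1 \<xi>\<bar>)"
        using int by simp
    qed (use C in \<open>auto simp: abs_mult intro!: mult_right_mono mult_nonneg_nonneg order_trans[OF abs_ge_zero C]\<close>)
    finally show ?thesis
      by (simp add: K)
  qed
  ultimately show ?thesis
    by (intro L2_unit_bounded) auto
qed

text \<open>This yields equality of functions, not merely almost everywhere, so the representative
  chosen by \<open>orth_proj\<close> can be replaced by its basis expansion.\<close>

lemma K_op_cong_L2_eq:
  assumes "f \<in> L2_unit" "g \<in> L2_unit" "L2_eq f g" "0 \<le> \<tau>"
  shows "K_op \<sigma> L U \<tau> f = K_op \<sigma> L U \<tau> g"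
  using assms by (auto simp: K_op_eq_L2_inner intro!: L2_inner_cong_left kappa_shift_L2_unit)

lemma K_op_lincomb:
  assumes "\<And>i. i \<in> I \<Longrightarrow> f i \<in> L2_unit" "0 \<le> \<tau>"
  shows "K_op \<sigma> L U \<tau> (\<lambda>x. \<Sum>i\<in>I. c i * f i x) = (\<lambda>z. \<Sum>i\<in>I. c i * K_op \<sigma> L U \<tau> (f i) z)"
proof
  show "K_op \<sigma> L U \<tau> (\<lambda>x. \<Sum>i\<in>I. c i * f i x) z = (\<Sum>i\<in>I. c i * K_op \<sigma> L U \<tau> (f i) z)" for z
    unfolding K_op_eq_L2_inner using assms by (intro L2_inner_lincomb_left kappa_shift_L2_unit)
qed

lemma f0_L2_unit: "f0 rhat \<sigma> L U E \<in> L2_unit"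
proof -
  let ?h = "\<lambda>z. L * exp (- alpha rhat \<sigma> * theta L U * z) * (exp (theta L U * z) - exp (Estar L E))"
  have "compact (?h ` {0..1})"
    by (intro compact_continuous_image) (auto intro!: continuous_intros)
  then obtain C where C: "\<forall>y\<in>?h ` {0..1}. norm y \<le> C"
    using compact_imp_bounded bounded_iff by blast
  have "set_borel_measurable lborel {0..1} (f0 rhat \<sigma> L U E)"
    unfolding set_borel_measurable_def f0_def by measurable
  moreover have "\<bar>f0 rhat \<sigma> L U E z\<bar> \<le> \<bar>C\<bar>" if "z \<in> {0..1}" for z
  proof -
    have "\<bar>?h z\<bar> \<le> C"
      using C that by auto
    then show ?thesis
      by (auto simp: f0_def indicator_def)
  qed
  ultimately show "f0 rhat \<sigma> L U E \<in> L2_unit"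
    by (rule L2_unit_bounded)
qed

text \<open>\<open>pow_mat\<close> multiplies the new factor on the right, but a time step applies
  the matrix on the left.\<close>

lemma pow_mat_Suc_left:
  assumes "A \<in> carrier_mat n n"
  shows "A ^\<^sub>m Suc k = A * A ^\<^sub>m k"
proof (induction k)
  case 0
  then show ?case
    using assms by simp
next
  case (Suc k)
  have "A ^\<^sub>m Suc (Suc k) = (A * A ^\<^sub>m k) * A"
    using Suc by simp
  also have "\<dots> = A * A ^\<^sub>m Suc k"
    using assoc_mult_mat[OF assms pow_carrier_mat[OF assms] assms] by simp
  finally show ?case .
qed

theorem mainTheorem3:
  fixes rhat \<sigma> L U E T \<tau> :: real
    and M r J N m :: nat
    and \<psi> :: "nat \<Rightarrow> real \<Rightarrow> real"
    and e :: "nat \<Rightarrow> nat \<times> nat \<times> nat"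
    and F1 :: "real Matrix.vec" and K :: "real Matrix.mat"
  assumes "\<sigma> > 0" and "0 < L" and "L < U" and "E > 0" and "T > 0"
    and "M \<ge> 1" and "\<tau> = T / real M"
    and "r \<ge> 1" and "N = r * 2 ^ J"
    and psi_basis: "orthonormal_basis_of (W0_space r) r \<psi>"
    and psi_zero: "\<forall>l<r. \<forall>x. x \<notin> {0..<1} \<longrightarrow> \<psi> l x = 0"
    and enum: "bij_betw e {r..<N} (wavelet_index r J)"
    and F1: "F1 = Matrix.vec N (\<lambda>i.
      LBINT \<eta>:{0..1}. LBINT \<xi>:{delta L E / theta L U .. 1}.
        psi_bar r \<psi> e i \<eta> * kappa \<sigma> L U (\<eta> - \<xi>) \<tau> * f0 rhat \<sigma> L U E \<xi>)"
    and K: "K = Matrix.mat N N (\<lambda>(i, j).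
      LBINT \<eta>:{0..1}. LBINT \<xi>:{0..1}.
        psi_bar r \<psi> e i \<eta> * psi_bar r \<psi> e j \<xi> * kappa \<sigma> L U (\<eta> - \<xi>) \<tau>)"
    and "1 \<le> m" and "m \<le> M"
  shows "L2_eq (f_approx rhat \<sigma> L U E \<tau> r J m)
           (\<lambda>z. \<Sum>i<N. vec_index (K ^\<^sub>m (m - 1) *\<^sub>v F1) i * psi_bar r \<psi> e i z)"
proof -
  let ?K = "K_op \<sigma> L U \<tau>" and ?b = "psi_bar r \<psi> e" and ?V = "V_space r J"
  let ?f = "f_approx rhat \<sigma> L U E \<tau> r J"
  have \<tau>: "0 \<le> \<tau>" and r: "0 < r"
    using assms by auto
  have basis: "orthonormal_basis_of ?V N ?b"
    using psi_bar_orthonormal_basis[OF r psi_basis, of e J] psi_zero enum \<open>N = r * 2 ^ J\<close> by auto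
  then have bV: "?b i \<in> ?V" if "i < N" for i
    using that by (simp add: orthonormal_basis_of_def)
  then have b: "?b i \<in> L2_unit" if "i < N" for i
    using that V_space_L2_unit by blast
  have lin: "(\<lambda>x. \<Sum>i<N. c i * ?b i x) \<in> ?V" for c
    using bV by (intro V_space_lincomb r) auto
  note proj = orth_proj_orthonormal_basis[OF basis V_space_L2_unit lin]
  have Kc: "K \<in> carrier_mat N N" and Fc: "F1 \<in> carrier_vec N"
    by (auto simp: K F1)
  have step: "?f (Suc m) \<in> ?V"
    "L2_eq (?f (Suc m)) (\<lambda>x. \<Sum>i<N. L2_inner (?K (?f m)) (?b i) * ?b i x)"
    if "?f m \<in> L2_unit" for m
    using proj[OF K_op_L2_unit[OF that \<tau>]] by simp_all
  have F1_index: "vec_index F1 i = L2_inner (?K (?f 0)) (?b i)" if i: "i < N" for i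
  proof -
    let ?g = "f0 rhat \<sigma> L U E"
    have "0 < theta L U" "0 \<le> delta L E"
      using assms by (auto simp: theta_def delta_def)
    \<comment> \<open>\<open>f0\<close> carries the indicator of the shorter interval, and its left
      end is nonnegative, so integrating over that interval or over \<open>{0..1}\<close> gives the
      same value.\<close>
    then have "0 \<le> delta L E / theta L U"
      by simp
    then have ind: "indicat_real {delta L E / theta L U..1} \<xi> *\<^sub>R (kappa \<sigma> L U (\<eta> - \<xi>) \<tau> * ?g \<xi>)
        = indicat_real {0..1} \<xi> *\<^sub>R (kappa \<sigma> L U (\<eta> - \<xi>) \<tau> * ?g \<xi>)" for \<eta> \<xi>
      by (auto simp: f0_def indicator_def)
    have "(LBINT \<xi>:{delta L E / theta L U..1}. ?b i \<eta> * kappa \<sigma> L U (\<eta> - \<xi>) \<tau> * ?g \<xi>)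
        = ?b i \<eta> * (LBINT \<xi>:{delta L E / theta L U..1}. kappa \<sigma> L U (\<eta> - \<xi>) \<tau> * ?g \<xi>)" for \<eta>
      by (simp only: mult.assoc set_integral_mult_right)
    also have "\<dots> \<eta> = ?K ?g \<eta> * ?b i \<eta>" for \<eta>
      unfolding K_op_def set_lebesgue_integral_def ind by simp
    finally show ?thesis
      using i by (simp add: F1 L2_inner_def)
  qed
  have K_index: "K $$ (i, j) = L2_inner (?K (?b j)) (?b i)" if "i < N" "j < N" for i j
  proof -
    have "(LBINT \<xi>:{0..1}. ?b i \<eta> * ?b j \<xi> * kappa \<sigma> L U (\<eta> - \<xi>) \<tau>)
        = (LBINT \<xi>:{0..1}. ?b i \<eta> * (kappa \<sigma> L U (\<eta> - \<xi>) \<tau> * ?b j \<xi>))" for \<eta>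
      by (simp add: ac_simps)
    then have "(LBINT \<xi>:{0..1}. ?b i \<eta> * ?b j \<xi> * kappa \<sigma> L U (\<eta> - \<xi>) \<tau>) = ?K (?b j) \<eta> * ?b i \<eta>" for \<eta>
      by (simp add: K_op_def mult.commute)
    then show ?thesis
      using that by (simp add: K L2_inner_def)
  qed
  \<comment> \<open>The induction starts at the first projected step, as \<open>f0\<close> itself
    need not lie in the space; hence the exponent m - 1. Membership is carried along because the
    next step needs square integrability.\<close>
  have "?f (Suc n) \<in> ?V \<and> L2_eq (?f (Suc n)) (\<lambda>z. \<Sum>i<N. vec_index (K ^\<^sub>m n *\<^sub>v F1) i * ?b i z)" for n
  proof (induction n)
    case 0
    have "?f 0 \<in> L2_unit"
      by (simp add: f0_L2_unit)
    from step[OF this] show ?case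
      using Kc Fc by (simp add: F1_index)
  next
    case (Suc n)
    define v where "v = K ^\<^sub>m n *\<^sub>v F1"
    have vc: "v \<in> carrier_vec N"
      unfolding v_def by (rule mult_mat_vec_carrier[OF pow_carrier_mat[OF Kc] Fc])
    have f: "?f (Suc n) \<in> L2_unit"
      using Suc V_space_L2_unit by blast
    have "(\<lambda>z. \<Sum>i<N. vec_index v i * ?b i z) \<in> L2_unit"
      using lin V_space_L2_unit by blast
    then have "?K (?f (Suc n)) = ?K (\<lambda>z. \<Sum>i<N. vec_index v i * ?b i z)"
      using Suc \<tau> by (intro K_op_cong_L2_eq f) (auto simp: v_def)
    also have "\<dots> = (\<lambda>z. \<Sum>i<N. vec_index v i * ?K (?b i) z)"
      using b \<tau> by (intro K_op_lincomb) auto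
    finally have Kf: "?K (?f (Suc n)) = (\<lambda>z. \<Sum>i<N. vec_index v i * ?K (?b i) z)" .
    \<comment> \<open>Entry (i, j) of the matrix pairs the image of basis function \<open>j\<close>
      with basis function \<open>i\<close>, so expanding the previous approximation gives row
      \<open>i\<close> of the product with \<open>v\<close>.\<close>
    have "L2_inner (?K (?f (Suc n))) (?b i) = vec_index (K ^\<^sub>m Suc n *\<^sub>v F1) i" if i: "i < N" for i
    proof -
      have "L2_inner (?K (?f (Suc n))) (?b i) = (\<Sum>j<N. vec_index v j * L2_inner (?K (?b j)) (?b i))"
        unfolding Kf using b i \<tau> by (intro L2_inner_lincomb_left) (auto intro: K_op_L2_unit)
      also have "\<dots> = (\<Sum>j<N. K $$ (i, j) * vec_index v j)"
        using i by (simp add: K_index mult.commute)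
      also have "\<dots> = vec_index (K *\<^sub>v v) i"
        using i Kc vc by (auto simp: scalar_prod_def lessThan_atLeast0 intro!: sum.cong)
      also have "K *\<^sub>v v = K ^\<^sub>m Suc n *\<^sub>v F1"
        unfolding v_def pow_mat_Suc_left[OF Kc]
        by (rule assoc_mult_mat_vec[OF Kc pow_carrier_mat[OF Kc] Fc, symmetric])
      finally show ?thesis .
    qed
    with step[OF f] show ?case
      by (simp del: f_approx.simps pow_mat.simps)
  qed
  from this[of "m - 1"] show ?thesis
    using \<open>1 \<le> m\<close> by simp
qed

end
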